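(* Let $1\le s\le n$ and $0<\gamma<1$. Let $\boldsymbol{\Phi}\in\mathbb{R}^{m\times d}$ have rows drawn i.i.d. from $N(\mathbf{0},\boldsymbol{\Sigma})$, where the positive definite covariance $\boldsymbol{\Sigma}$ has smallest and largest singular values $\sigma_{\min}^2,\sigma_{\max}^2$ and condition number $\kappa=\sigma_{\max}^2/\sigma_{\min}^2$. Let $\mathbf{D}=[\mathbf{d}_1,\dots,\mathbf{d}_n]\in\mathbb{R}^{d\times n}$ satisfy $\inf\{\|\mathbf{D}\mathbf{x}\|_2:\mathbf{x}\in S_\gamma\}\ge\eta$ for some $\eta>0$ and $\max_i\|\mathbf{d}_i\|_2^2\le\rho$. If \[ m\ \ge\ \frac{18\cdot 2^9\pi e}{\eta^2}\,\frac{\rho\kappa}{\gamma^2}\,s\log(2n), \] then with probability at least $1-\exp\!\left(-\frac{m}{128e\pi}\right)$, the matrix $\boldsymbol{\Phi}\mathbf{D}$ has the null space property of order $s$.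
   Context: For $\mathbf{x}\in\mathbb{R}^n$ and $T\subset[n]$, $\mathbf{x}_T$ agrees with $\mathbf{x}$ on $T$ and is $0$ elsewhere, $T^c=[n]\setminus T$. $S_\gamma:=\{\mathbf{x}\in\mathbb{R}^n:\|\mathbf{x}\|_2=1,\ \|\mathbf{x}_T\|_1\ge\gamma\|\mathbf{x}_{T^c}\|_1\text{ for some }|T|\le s\}$. A matrix $\mathbf{A}$ with $n$ columns has the null space property of order $s$ if $\|\mathbf{x}_T\|_1<\|\mathbf{x}_{T^c}\|_1$ for every $\mathbf{x}\in\ker\mathbf{A}\setminus\{0\}$ and every $T\subset[n]$ with $|T|\le s$. *)

theory Defs
  imports "HOL-Probability.Probability"
begin

definition l1_on :: "'n::finite set \<Rightarrow> real^'n \<Rightarrow> real" where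
  "l1_on T x = (\<Sum>i\<in>T. \<bar>x $ i\<bar>)"

definition S_gamma :: "nat \<Rightarrow> real \<Rightarrow> (real^'n::finite) set" where
  "S_gamma s \<gamma> = {x. norm x = 1 \<and>
      (\<exists>T::'n set. card T \<le> s \<and> l1_on T x \<ge> \<gamma> * l1_on (- T) x)}"

definition null_space_property :: "real^'n::finite^'k \<Rightarrow> nat \<Rightarrow> bool" where
  "null_space_property A s \<longleftrightarrow>
     (\<forall>x. A *v x = 0 \<and> x \<noteq> 0 \<longrightarrow>
        (\<forall>T::'n set. card T \<le> s \<longrightarrow> l1_on T x < l1_on (- T) x))"

definition pos_def_matrix :: "real^'d::finite^'d \<Rightarrow> bool" where
  "pos_def_matrix S \<longleftrightarrow> transpose S = S \<and> (\<forall>x. x \<noteq> 0 \<longrightarrow> x \<bullet> (S *v x) > 0)"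

definition singular_values :: "real^'d::finite^'k \<Rightarrow> real set" where
  "singular_values S = {sqrt \<mu> | \<mu>. \<exists>v. v \<noteq> 0 \<and> (transpose S ** S) *v v = \<mu> *\<^sub>R v}"

definition cond_number :: "real^'d::finite^'k \<Rightarrow> real" where
  "cond_number S = Max (singular_values S) / Min (singular_values S)"

definition mvnormal :: "real^'d::finite^'d \<Rightarrow> (real^'d) measure" where
  "mvnormal S = density lborel (\<lambda>x. ennreal
      (exp (- (x \<bullet> (matrix_inv S *v x)) / 2) /
       sqrt ((2 * pi) ^ CARD('d) * det S)))"

definition gauss_rows :: "real^'d::finite^'d \<Rightarrow> ('m::finite \<Rightarrow> real^'d) measure" where
  "gauss_rows S = PiM UNIV (\<lambda>_. mvnormal S)"

definition rows_matrix :: "('m::finite \<Rightarrow> real^'d) \<Rightarrow> real^'d^'m" where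
  "rows_matrix \<Phi> = (\<chi> i. \<Phi> i)"

end

theory Submission
  imports Defs
begin

text \<open>
  Put \<open>q z = \<parallel>\<Phi> D z\<parallel>\<^sup>2 - (m/4) (D z) \<bullet> (\<Sigma> D z)\<close>.  By Maurey's empirical method, a vector \<open>x\<close> with
  \<open>\<parallel>x\<parallel>\<^sub>1 = 1\<close> is the mean of a random signed coordinate vector, and the expectation of \<open>q\<close> at a sum of
  \<open>k\<close> independent copies is \<open>k\<close> times the mean of \<open>q\<close> over single copies plus \<open>k (k - 1) q x\<close>.  So if
  \<open>q \<ge> 0\<close> at each of the at most \<open>(2 n)\<^sup>k\<close> such sums and the columns of \<open>\<Phi> D\<close> are not too long, then
  \<open>q x\<close> is bounded below by a multiple of \<open>- 1 / (k - 1)\<close>.  A kernel vector violating the null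
  space property makes \<open>q x\<close> more negative than that once \<open>k\<close> exceeds a multiple of
  \<open>s \<rho> \<kappa> / \<eta>\<^sup>2\<close>.  Both conditions hold outside an event whose probability is estimated by a union
  bound over chi-square tails.
\<close>

subsection \<open>Linear change of variables\<close>

lemma power2_norm_vec:
  fixes x :: "real^'n::finite"
  shows "(norm x)\<^sup>2 = (\<Sum>i\<in>UNIV. (x $ i)\<^sup>2)"
  by (simp add: norm_vec_def L2_set_def sum_nonneg)

lemma borel_measurable_vec_lambda [measurable (raw)]:
  fixes f :: "'a \<Rightarrow> 'n::finite \<Rightarrow> 'b::euclidean_space"
  assumes "\<And>i. (\<lambda>x. f x i) \<in> borel_measurable M"
  shows "(\<lambda>x. \<chi> i. f x i) \<in> borel_measurable M"
  using assms by (subst borel_measurable_euclidean_space) (auto simp: Basis_vec_def inner_axis)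

lemma borel_measurable_vec_nth [measurable (raw)]:
  fixes f :: "'a \<Rightarrow> real^'n::finite"
  assumes "f \<in> borel_measurable M"
  shows "(\<lambda>x. f x $ i) \<in> borel_measurable M"
proof -
  have "(\<lambda>x. f x \<bullet> axis i 1) \<in> borel_measurable M"
    using assms by measurable
  then show ?thesis by (simp add: inner_axis)
qed

text \<open>Lebesgue measure is determined by its values on boxes, and on a box both sides give the
  product of the side lengths. This opens the way to integrating one coordinate at a time.\<close>

lemma lborel_vec_PiM:
  "(lborel :: (real^'n::finite) measure) = distr (PiM UNIV (\<lambda>_. lborel)) borel (\<lambda>f. \<chi> i. f i)"
    (is "_ = ?M")
proof (rule lborel_eqI)
  fix l u :: "real^'n"
  assume le: "\<And>b. b \<in> Basis \<Longrightarrow> l \<bullet> b \<le> u \<bullet> b"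
  have le': "l $ i \<le> u $ i" for i
    using le[of "axis i 1"] by (auto simp: inner_axis Basis_vec_def)
  interpret product_sigma_finite "\<lambda>_::'n. lborel :: real measure" by standard
  have "emeasure ?M (box l u) = emeasure (PiM UNIV (\<lambda>_::'n. lborel)) (PiE UNIV (\<lambda>i. {l$i<..<u$i}))"
    by (subst emeasure_distr)
      (auto simp: space_PiM mem_box_cart PiE_def Pi_def intro!: arg_cong[where f="emeasure _"])
  also have "\<dots> = (\<Prod>i\<in>UNIV. emeasure lborel {l$i<..<u$i})"
    by (subst emeasure_PiM) auto
  also have "\<dots> = ennreal (\<Prod>i\<in>UNIV. u$i - l$i)"
    using le' by (simp add: prod_ennreal)
  also have "(\<Prod>i\<in>UNIV. u$i - l$i) = (\<Prod>b\<in>Basis. (u - l) \<bullet> b)"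
    by (simp add: Basis_vec_def prod.UNION_disjoint inner_axis UNION_singleton_eq_range
        axis_eq_axis inj_on_def prod.reindex)
  finally show "emeasure ?M (box l u) = ennreal (\<Prod>b\<in>Basis. (u - l) \<bullet> b)" .
qed simp

text \<open>By Fubini the \<open>m\<close>-th coordinate can be integrated first; with the others
  fixed, the shear only translates it by \<open>x$n\<close>.\<close>

lemma nn_integral_lborel_shear:
  fixes g :: "real^'n::finite \<Rightarrow> ennreal"
  assumes mn: "m \<noteq> n" and [measurable]: "g \<in> borel_measurable borel"
  shows "(\<integral>\<^sup>+x. g (\<chi> i. if i = m then x$m + x$n else x$i) \<partial>lborel) = (\<integral>\<^sup>+x. g x \<partial>lborel)"
proof -
  interpret product_sigma_finite "\<lambda>_::'n. lborel :: real measure" by standard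
  define s :: "real^'n \<Rightarrow> real^'n" where "s x = (\<chi> i. if i = m then x$m + x$n else x$i)" for x
  have [measurable]: "s \<in> borel_measurable borel"
    unfolding s_def by measurable
  have U: "(UNIV::'n set) = insert m (UNIV - {m})" by auto
  have split: "(\<integral>\<^sup>+x. h x \<partial>lborel)
      = (\<integral>\<^sup>+y. (\<integral>\<^sup>+t. h (\<chi> i. (y(m := t)) i) \<partial>lborel) \<partial>PiM (UNIV - {m}) (\<lambda>_. lborel))"
    if [measurable]: "h \<in> borel_measurable borel" for h :: "real^'n \<Rightarrow> ennreal"
  proof -
    have "(\<integral>\<^sup>+x. h x \<partial>lborel) = (\<integral>\<^sup>+f. h (\<chi> i. f i) \<partial>PiM UNIV (\<lambda>_::'n. lborel))"
      by (subst lborel_vec_PiM) (simp add: nn_integral_distr)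
    also have "\<dots> = (\<integral>\<^sup>+f. h (\<chi> i. f i) \<partial>PiM (insert m (UNIV - {m})) (\<lambda>_::'n. lborel))"
      using U by simp
    also have "\<dots> = (\<integral>\<^sup>+y. (\<integral>\<^sup>+t. h (\<chi> i. (y(m := t)) i) \<partial>lborel) \<partial>PiM (UNIV - {m}) (\<lambda>_. lborel))"
    proof (rule product_nn_integral_insert)
      show "(\<lambda>f. h (\<chi> i. f i)) \<in> borel_measurable (PiM (insert m (UNIV - {m})) (\<lambda>_. lborel))"
        unfolding U[symmetric] by measurable
    qed auto
    finally show ?thesis .
  qed
  have "(\<integral>\<^sup>+t. g (s (\<chi> i. (y(m := t)) i)) \<partial>lborel) = (\<integral>\<^sup>+t. g (\<chi> i. (y(m := t)) i) \<partial>lborel)" for y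
  proof -
    \<comment> \<open>The factor \<open>1 * t\<close> puts the translation into the shape of
      \<open>nn_integral_real_affine\<close>.\<close>
    have eq: "s (\<chi> i. (y(m := t)) i) = (\<chi> i. (y(m := y n + 1 * t)) i)" for t
      using mn by (auto simp: s_def vec_eq_iff)
    have [measurable]: "(\<lambda>t. (\<chi> i. (y(m := t)) i) :: real^'n) \<in> borel_measurable borel"
      by (simp only: fun_upd_apply) measurable
    show ?thesis
      unfolding eq by (subst (2) nn_integral_real_affine[where c=1 and t="y n"]) simp_all
  qed
  then show ?thesis
    unfolding s_def[symmetric] by (subst (1 2) split) (simp_all del: fun_upd_apply)
qed

text \<open>The preimage of a box is the box with two of its sides exchanged, so the map preserves
  volume.\<close>

lemma nn_integral_lborel_swap:
  fixes g :: "real^'n::finite \<Rightarrow> ennreal"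
  assumes [measurable]: "g \<in> borel_measurable borel"
  shows "(\<integral>\<^sup>+x. g (\<chi> i. x $ Transposition.transpose m n i) \<partial>lborel) = (\<integral>\<^sup>+x. g x \<partial>lborel)"
proof -
  define s :: "real^'n \<Rightarrow> real^'n" where "s x = (\<chi> i. x $ Transposition.transpose m n i)" for x
  have [measurable]: "s \<in> borel_measurable borel"
    unfolding s_def by measurable
  have prod: "(\<Prod>b\<in>Basis. (u - l) \<bullet> b) = (\<Prod>i\<in>UNIV. u$i - l$i)" for l u :: "real^'n"
    by (simp add: Basis_vec_def inner_axis UNION_singleton_eq_range
        axis_eq_axis inj_on_def prod.reindex)
  have "lborel = distr lborel borel s"
  proof (rule lborel_eqI)
    fix l u :: "real^'n"
    assume le: "\<And>b. b \<in> Basis \<Longrightarrow> l \<bullet> b \<le> u \<bullet> b"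
    have le': "l $ i \<le> u $ i" for i
      using le[of "axis i 1"] by (auto simp: inner_axis Basis_vec_def)
    have "s -` box l u = box (s l) (s u)"
      by (auto simp: s_def mem_box_cart) (metis transpose_involutory)+
    then have "emeasure (distr lborel borel s) (box l u) = emeasure lborel (box (s l) (s u))"
      by (simp add: emeasure_distr)
    also have "\<dots> = ennreal (\<Prod>b\<in>Basis. (s u - s l) \<bullet> b)"
      using le' by (subst emeasure_lborel_box_eq) (auto simp: Basis_vec_def inner_axis s_def)
    also have "(\<Prod>b\<in>Basis. (s u - s l) \<bullet> b) = (\<Prod>b\<in>Basis. (u - l) \<bullet> b)"
      unfolding prod s_def
      using prod.permute[OF permutes_swap_id, where S=UNIV and g="\<lambda>i. u$i - l$i", of m n]
      by (simp add: o_def)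
    finally show "emeasure (distr lborel borel s) (box l u) = ennreal (\<Prod>b\<in>Basis. (u - l) \<bullet> b)" .
  qed simp
  then have "(\<integral>\<^sup>+x. g x \<partial>lborel) = (\<integral>\<^sup>+x. g x \<partial>distr lborel borel s)" by simp
  then show ?thesis
    by (simp add: nn_integral_distr s_def)
qed

lemma nn_integral_lborel_stretch:
  fixes g :: "real^'n::finite \<Rightarrow> ennreal"
  assumes [measurable]: "g \<in> borel_measurable borel" and c: "\<And>i. c i \<noteq> 0"
  shows "ennreal \<bar>\<Prod>i\<in>UNIV. c i\<bar> * (\<integral>\<^sup>+x. g (\<chi> i. c i * x $ i) \<partial>lborel) = (\<integral>\<^sup>+x. g x \<partial>lborel)"
proof -
  \<comment> \<open>\<open>d\<close> carries the factors \<open>c\<close> from coordinates over to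
    the vectors of \<open>Basis\<close>, as \<open>lborel_affine_euclidean\<close> expects.\<close>
  define d :: "real^'n \<Rightarrow> real" where "d b = (\<chi> i. c i) \<bullet> b" for b
  define T :: "real^'n \<Rightarrow> real^'n" where "T x = 0 + (\<Sum>j\<in>Basis. (d j * (x \<bullet> j)) *\<^sub>R j)" for x
  have T: "T x = (\<chi> i. c i * x $ i)" for x
  proof -
    have "T x \<bullet> axis i 1 = c i * x $ i" for i
      unfolding T_def add_0 by (subst inner_sum_left_Basis) (simp_all add: d_def inner_axis)
    then show ?thesis by (simp add: vec_eq_iff inner_axis)
  qed
  have p: "(\<Prod>j\<in>Basis. ennreal \<bar>d j\<bar>) = ennreal \<bar>\<Prod>i\<in>UNIV. c i\<bar>"
    by (simp add: d_def Basis_vec_def inner_axis UNION_singleton_eq_range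
        axis_eq_axis inj_on_def prod.reindex abs_prod prod_ennreal)
  have [measurable]: "T \<in> borel_measurable borel"
    unfolding T_def by simp
  have "lborel = density (distr lborel borel T) (\<lambda>_. (\<Prod>j\<in>Basis. \<bar>d j\<bar>))"
    unfolding T_def
    by (rule lborel_affine_euclidean) (use c in \<open>auto simp: d_def Basis_vec_def inner_axis\<close>)
  then have "(\<integral>\<^sup>+x. g x \<partial>lborel) = (\<integral>\<^sup>+x. g x \<partial>density (distr lborel borel T) (\<lambda>_. (\<Prod>j\<in>Basis. \<bar>d j\<bar>)))"
    by simp
  also have "\<dots> = ennreal \<bar>\<Prod>i\<in>UNIV. c i\<bar> * (\<integral>\<^sup>+x. g (T x) \<partial>lborel)"
    by (simp add: nn_integral_density nn_integral_distr nn_integral_cmult p[symmetric] prod_ennreal)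
  finally show ?thesis by (simp add: T)
qed

text \<open>
  The change of variables theorems of the library require the index type to be a \<open>wellorder\<close>.
\<close>

lemma nn_integral_lborel_linear:
  fixes f :: "real^'n::finite \<Rightarrow> real^'n"
  assumes "linear f" and "det (matrix f) \<noteq> 0" and "g \<in> borel_measurable borel"
  shows "ennreal \<bar>det (matrix f)\<bar> * (\<integral>\<^sup>+x. g (f x) \<partial>lborel) = (\<integral>\<^sup>+x. g x \<partial>lborel)"
proof -
  \<comment> \<open>The quantifier over \<open>g\<close> sits inside \<open>P\<close> because the
    step for a composition applies one hypothesis to \<open>h\<close> and the other to
    \<open>h\<close> composed with a linear map. Singular maps satisfy \<open>P\<close>
    vacuously.\<close>
  define P where "P f \<longleftrightarrow> (det (matrix f) \<noteq> 0 \<longrightarrow> (\<forall>g \<in> borel_measurable borel.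
      ennreal \<bar>det (matrix f)\<bar> * (\<integral>\<^sup>+x. g (f x) \<partial>lborel) = (\<integral>\<^sup>+x. g x \<partial>lborel)))"
    for f :: "real^'n \<Rightarrow> real^'n"
  have "P f"
  proof (rule induct_linear_elementary[OF \<open>linear f\<close>])
    fix f g :: "real^'n \<Rightarrow> real^'n"
    assume lin: "linear f" "linear g" and Pf: "P f" and Pg: "P g"
    have det: "det (matrix (f \<circ> g)) = det (matrix f) * det (matrix g)"
      using matrix_compose[OF lin(2,1)] by (simp add: det_mul)
    have [measurable]: "f \<in> borel_measurable borel"
      using lin(1) by (intro borel_measurable_continuous_onI linear_continuous_on)
        (simp add: linear_conv_bounded_linear)
    show "P (f \<circ> g)"
      unfolding P_def
    proof (intro impI ballI)
      fix h :: "real^'n \<Rightarrow> ennreal"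
      assume nz: "det (matrix (f \<circ> g)) \<noteq> 0" and h[measurable]: "h \<in> borel_measurable borel"
      have "ennreal \<bar>det (matrix g)\<bar> * (\<integral>\<^sup>+x. h (f (g x)) \<partial>lborel) = (\<integral>\<^sup>+x. h (f x) \<partial>lborel)"
        using Pg nz det unfolding P_def by (auto dest: bspec[where x="\<lambda>x. h (f x)"])
      moreover have "ennreal \<bar>det (matrix f)\<bar> * (\<integral>\<^sup>+x. h (f x) \<partial>lborel) = (\<integral>\<^sup>+x. h x \<partial>lborel)"
        using Pf nz det h unfolding P_def by auto
      ultimately show "ennreal \<bar>det (matrix (f \<circ> g))\<bar> * (\<integral>\<^sup>+x. h ((f \<circ> g) x) \<partial>lborel) = (\<integral>\<^sup>+x. h x \<partial>lborel)"
        by (simp add: det abs_mult ennreal_mult' mult.assoc)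
    qed
  next
    fix f :: "real^'n \<Rightarrow> real^'n" and i
    assume "linear f" and "\<And>x. f x $ i = 0"
    then have "\<not> inj f"
      by (metis (full_types) linear_injective_imp_surjective one_neq_zero surjE vec_component)
    then show "P f"
      using det_nz_iff_inj[OF \<open>linear f\<close>] by (simp add: P_def)
  next
    fix c :: "'n \<Rightarrow> real"
    have "det (matrix (\<lambda>x::real^'n. \<chi> i. c i * x $ i)) = (\<Prod>i\<in>UNIV. c i)"
      by (subst det_diagonal) (auto simp: matrix_def axis_def)
    then show "P (\<lambda>x. \<chi> i. c i * x $ i)"
      unfolding P_def using nn_integral_lborel_stretch[where c=c] by auto
  next
    fix m n :: 'n
    have "matrix (\<lambda>x::real^'n. \<chi> i. x $ Transposition.transpose m n i)
        = (\<chi> i. mat 1 $ Transposition.transpose m n i)"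
      by (auto simp: matrix_def axis_def mat_def vec_eq_iff)
    then have "\<bar>det (matrix (\<lambda>x::real^'n. \<chi> i. x $ Transposition.transpose m n i))\<bar> = 1"
      by (simp add: det_permute_rows permutes_swap_id sign_swap_id abs_mult)
    then show "P (\<lambda>x. \<chi> i. x $ Transposition.transpose m n i)"
      unfolding P_def by (simp add: nn_integral_lborel_swap)
  next
    fix m n :: 'n
    assume mn: "m \<noteq> n"
    have "matrix (\<lambda>x::real^'n. \<chi> i. if i = m then x$m + x$n else x$i)
        = (\<chi> k. if k = m then row m (mat 1) + 1 *s row n (mat 1) else row k (mat 1))"
      by (auto simp: matrix_def axis_def mat_def vec_eq_iff row_def)
    then have "det (matrix (\<lambda>x::real^'n. \<chi> i. if i = m then x$m + x$n else x$i)) = 1"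
      using det_row_operation[OF mn, of "mat 1 :: real^'n^'n" 1] by simp
    then show "P (\<lambda>x. \<chi> i. if i = m then x$m + x$n else x$i)"
      unfolding P_def using mn by (simp add: nn_integral_lborel_shear)
  qed
  then show ?thesis
    using assms by (simp add: P_def)
qed

subsection \<open>The multivariate normal distribution\<close>

lemma symmetric_matrix_inner:
  fixes S :: "real^'d::finite^'d"
  assumes "transpose S = S"
  shows "x \<bullet> (S *v y) = (S *v x) \<bullet> y"
  by (metis assms dot_lmul_matrix transpose_matrix_vector)

text \<open>Gram-Schmidt for the inner product \<open>x \<bullet> (S *v y)\<close>, started at
  \<open>u\<close>. Fewer than \<open>CARD('d)\<close> vectors cannot span the space, so a new
  direction is always available.\<close>

lemma pos_def_matrix_orthonormal_extension:
  fixes S :: "real^'d::finite^'d"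
  assumes S: "pos_def_matrix S" and u: "u \<bullet> (S *v u) = 1" and k: "1 \<le> k" "k \<le> CARD('d)"
  shows "\<exists>B. finite B \<and> card B = k \<and> u \<in> B \<and>
    (\<forall>b\<in>B. \<forall>c\<in>B. b \<bullet> (S *v c) = (if b = c then 1 else 0))"
  using k
proof (induction k rule: nat_induct_at_least)
  case base
  show ?case by (rule exI[of _ "{u}"]) (simp add: u)
next
  case (Suc k)
  then obtain B where B: "finite B" "card B = k" "u \<in> B"
    and on: "\<And>b c. b \<in> B \<Longrightarrow> c \<in> B \<Longrightarrow> b \<bullet> (S *v c) = (if b = c then 1 else 0)"
    by auto
  have sym: "x \<bullet> (S *v y) = y \<bullet> (S *v x)" for x y
    using S symmetric_matrix_inner[of S x y] by (simp add: pos_def_matrix_def inner_commute)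
  have "span B \<noteq> UNIV"
  proof
    assume "span B = UNIV"
    then have "dim B = CARD('d)"
      by (metis dim_span dim_UNIV DIM_cart DIM_real mult.right_neutral)
    then have "CARD('d) \<le> card B"
      using dim_le_card'[OF B(1)] by simp
    then show False using Suc.prems B by simp
  qed
  then obtain x where x: "x \<notin> span B" by auto
  \<comment> \<open>The part of \<open>x\<close> that is left after its \<open>S\<close>-orthogonal
    projection to \<open>span B\<close> is removed.\<close>
  define y where "y = x - (\<Sum>b\<in>B. (b \<bullet> (S *v x)) *\<^sub>R b)"
  have ynB: "y \<notin> span B"
  proof
    assume "y \<in> span B"
    moreover have "(\<Sum>b\<in>B. (b \<bullet> (S *v x)) *\<^sub>R b) \<in> span B"
      by (intro span_sum span_scale span_base)
    ultimately have "y + (\<Sum>b\<in>B. (b \<bullet> (S *v x)) *\<^sub>R b) \<in> span B"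
      by (rule span_add)
    with x show False by (simp add: y_def)
  qed
  then have "y \<noteq> 0" using span_zero by auto
  then have pos: "y \<bullet> (S *v y) > 0"
    using S by (simp add: pos_def_matrix_def)
  have orth: "y \<bullet> (S *v c) = 0" if c: "c \<in> B" for c
  proof -
    have "y \<bullet> (S *v c) = x \<bullet> (S *v c) - (\<Sum>b\<in>B. (b \<bullet> (S *v x)) * (b \<bullet> (S *v c)))"
      by (simp add: y_def inner_diff_left inner_sum_left)
    also have "(\<Sum>b\<in>B. (b \<bullet> (S *v x)) * (b \<bullet> (S *v c))) = (\<Sum>b\<in>B. if b = c then b \<bullet> (S *v x) else 0)"
      by (intro sum.cong) (auto simp: on c)
    also have "\<dots> = c \<bullet> (S *v x)"
      using B c by simp
    finally show ?thesis using sym[of x c] by simp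
  qed
  define z where "z = (1 / sqrt (y \<bullet> (S *v y))) *\<^sub>R y"
  have zz: "z \<bullet> (S *v z) = 1"
    using pos by (simp add: z_def matrix_vector_mult_scaleR)
  have zo: "z \<bullet> (S *v c) = 0" "c \<bullet> (S *v z) = 0" if "c \<in> B" for c
    using orth[OF that] sym[of c y] by (simp_all add: z_def matrix_vector_mult_scaleR)
  have "z \<notin> B"
    using zo zz by auto
  then show ?case
    using B zz zo on by (intro exI[of _ "insert z B"]) auto
qed

text \<open>The rows of \<open>A\<close> are an \<open>S\<close>-orthonormal basis that contains
  \<open>u\<close>.\<close>

lemma pos_def_matrix_whitening:
  fixes S :: "real^'d::finite^'d" and k :: 'd
  assumes S: "pos_def_matrix S" and u: "u \<bullet> (S *v u) = 1"
  obtains A :: "real^'d^'d" where "A ** S ** transpose A = mat 1" and "A $ k = u"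
proof -
  have "1 \<le> CARD('d)" by (simp add: Suc_leI)
  then obtain B where B: "finite B" "card B = CARD('d)" "u \<in> B"
    and on: "\<And>b c. b \<in> B \<Longrightarrow> c \<in> B \<Longrightarrow> b \<bullet> (S *v c) = (if b = c then 1 else 0)"
    using pos_def_matrix_orthonormal_extension[OF S u, of "CARD('d)"] by blast
  obtain f where f: "bij_betw f (UNIV::'d set) B"
    using finite_same_card_bij[of "UNIV::'d set" B] B by auto
  then obtain j where j: "f j = u"
    using B(3) by (auto simp: bij_betw_def)
  \<comment> \<open>The transposition moves \<open>u\<close> from index \<open>j\<close> of the
    enumeration to the prescribed index \<open>k\<close>.\<close>
  define r where "r = f \<circ> Transposition.transpose k j"
  have r: "bij_betw r UNIV B"
    unfolding r_def by (rule bij_betw_trans[OF _ f]) simp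
  have inj: "r a = r b \<longleftrightarrow> a = b" for a b
    using r by (auto simp: bij_betw_def inj_on_def)
  have rB: "r a \<in> B" for a
    using r by (auto simp: bij_betw_def)
  define A :: "real^'d^'d" where "A = (\<chi> i. r i)"
  have "(A ** S ** transpose A) $ a $ b = r a \<bullet> (S *v r b)" for a b
    by (simp add: A_def matrix_matrix_mult_def matrix_vector_mult_def transpose_def inner_vec_def
        sum_distrib_left sum_distrib_right mult.assoc) (rule sum.swap)
  then have "A ** S ** transpose A = mat 1"
    by (intro vec_eq_iff[THEN iffD2] allI) (simp add: mat_def on rB inj)
  moreover have "A $ k = u"
    by (simp add: A_def r_def j)
  ultimately show ?thesis using that by blast
qed

lemma matrix_inv_unique:
  fixes A B :: "'a::semiring_1^'n::finite^'n"
  assumes "A ** B = mat 1" and "B ** A = mat 1"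
  shows "matrix_inv A = B"
proof -
  have "A ** matrix_inv A = mat 1 \<and> matrix_inv A ** A = mat 1"
    unfolding matrix_inv_def by (rule someI[of _ B]) (use assms in simp)
  then show ?thesis
    by (metis assms(2) matrix_mul_assoc matrix_mul_lid matrix_mul_rid)
qed

text \<open>The hypothesis makes \<open>transpose A ** A\<close> the inverse of \<open>S\<close>.
  The two conclusions turn the exponent and the normalising factor of the density of
  \<open>mvnormal S\<close> into those of the standard normal density at
  \<open>A *v x\<close>.\<close>

lemma whitening_density:
  fixes A S :: "real^'d::finite^'d"
  assumes "A ** S ** transpose A = mat 1"
  shows "x \<bullet> (matrix_inv S *v x) = (norm (A *v x))\<^sup>2" and "(det A)\<^sup>2 * det S = 1"
proof -
  have 1: "S ** transpose A ** A = mat 1"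
    using assms matrix_left_right_inverse by (metis matrix_mul_assoc)
  then have 2: "S ** (transpose A ** A) = mat 1"
    by (simp add: matrix_mul_assoc)
  then have "matrix_inv S = transpose A ** A"
    by (intro matrix_inv_unique) (simp_all add: matrix_left_right_inverse)
  then show "x \<bullet> (matrix_inv S *v x) = (norm (A *v x))\<^sup>2"
    by (metis dot_lmul_matrix matrix_vector_mul_assoc power2_norm_eq_inner transpose_matrix_vector
        transpose_transpose)
  have "det (A ** S ** transpose A) = 1"
    using assms by simp
  then show "(det A)\<^sup>2 * det S = 1"
    by (simp add: det_mul det_transpose power2_eq_square ac_simps)
qed

text \<open>
  The whitening matrix is chosen with \<open>u\<close> as a row, so that \<open>u \<bullet> x\<close> becomes a coordinate of the
  standard normal vector \<open>A *v x\<close>.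
\<close>

lemma nn_integral_mvnormal_inner:
  fixes S :: "real^'d::finite^'d" and F :: "real \<Rightarrow> ennreal"
  assumes S: "pos_def_matrix S" and u: "u \<bullet> (S *v u) = 1" and [measurable]: "F \<in> borel_measurable borel"
  shows "(\<integral>\<^sup>+x. F (u \<bullet> x) \<partial>mvnormal S) = (\<integral>\<^sup>+t. ennreal (std_normal_density t) * F t \<partial>lborel)"
proof -
  interpret product_sigma_finite "\<lambda>_::'d. lborel :: real measure" by standard
  define k :: 'd where "k = undefined"
  obtain A where A: "A ** S ** transpose A = mat 1" and Ak: "A $ k = u"
    using pos_def_matrix_whitening[OF S u] by blast
  note wd = whitening_density[OF A]
  have detA: "det A \<noteq> 0" using wd(2) by auto
  have detS: "det S = 1 / (det A)\<^sup>2"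
    using wd(2) detA by (simp add: field_simps)
  have Axk: "(A *v x) $ k = u \<bullet> x" for x
    using Ak by (simp add: matrix_vector_mult_def inner_vec_def)
  define w :: "real^'d \<Rightarrow> real" where "w y = (\<Prod>i\<in>UNIV. std_normal_density (y $ i))" for y
  have w: "w y = exp (- (norm y)\<^sup>2 / 2) / sqrt ((2 * pi) ^ CARD('d))" for y
  proof -
    have "w y = (\<Prod>i\<in>UNIV. exp (- (y $ i)\<^sup>2 / 2)) * (1 / sqrt (2 * pi)) ^ CARD('d)"
      by (simp add: w_def std_normal_density_def prod_dividef power_one_over)
    also have "(\<Prod>i\<in>UNIV. exp (- (y $ i)\<^sup>2 / 2)) = exp (- (norm y)\<^sup>2 / 2)"
      by (simp add: power2_norm_vec exp_sum[symmetric] sum_negf sum_divide_distrib)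
    finally show ?thesis unfolding real_sqrt_power by (simp add: power_one_over field_simps)
  qed
  have wdens: "exp (- (x \<bullet> (matrix_inv S *v x)) / 2) / sqrt ((2 * pi) ^ CARD('d) * det S)
      = \<bar>det A\<bar> * w (A *v x)" for x
    by (simp add: wd(1) w detS real_sqrt_mult real_sqrt_divide)
  have [measurable]: "w \<in> borel_measurable borel"
    unfolding w_def by measurable
  have mA[measurable]: "(\<lambda>x. A *v x) \<in> borel_measurable borel"
    by (intro borel_measurable_continuous_onI) (simp add: continuous_on_id matrix_vector_mult_linear_continuous_on)
  have wn: "0 \<le> w y" for y
    by (simp add: w_def prod_nonneg)
  have "(\<integral>\<^sup>+x. F (u \<bullet> x) \<partial>mvnormal S)
      = (\<integral>\<^sup>+x. ennreal \<bar>det A\<bar> * (ennreal (w (A *v x)) * F ((A *v x) $ k)) \<partial>lborel)"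
    unfolding mvnormal_def wdens
    by (subst nn_integral_density) (auto simp: Axk ennreal_mult' mult.assoc)
  also have "\<dots> = ennreal \<bar>det A\<bar> * (\<integral>\<^sup>+x. ennreal (w (A *v x)) * F ((A *v x) $ k) \<partial>lborel)"
    by (rule nn_integral_cmult) measurable
  also have "\<dots> = (\<integral>\<^sup>+y. ennreal (w y) * F (y $ k) \<partial>lborel)"
    using nn_integral_lborel_linear[of "(*v) A" "\<lambda>y. ennreal (w y) * F (y $ k)"] detA
    by (simp add: matrix_of_matrix_vector_mul)
  \<comment> \<open>Written this way, the integrand is a product over the coordinates; every factor
    except the \<open>k\<close>-th integrates to 1.\<close>
  also have "\<dots> = (\<integral>\<^sup>+f. (\<Prod>i\<in>UNIV. ennreal (std_normal_density (f i)) * (if i = k then F (f i) else 1))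
      \<partial>PiM UNIV (\<lambda>_::'d. lborel))"
    by (subst lborel_vec_PiM) (simp add: nn_integral_distr w_def prod.distrib prod_ennreal)
  also have "\<dots> = (\<Prod>i\<in>UNIV. \<integral>\<^sup>+t. ennreal (std_normal_density t) * (if i = k then F t else 1) \<partial>lborel)"
    by (rule product_nn_integral_prod) auto
  also have "\<dots> = (\<Prod>i\<in>UNIV. if i = k then (\<integral>\<^sup>+t. ennreal (std_normal_density t) * F t \<partial>lborel) else 1)"
    by (intro prod.cong) (simp_all add: nn_integral_eq_integral)
  finally show ?thesis by simp
qed

text \<open>The total mass is the integral of the constant 1, which
  \<open>nn_integral_mvnormal_inner\<close> evaluates for any normalised direction; a rescaled
  coordinate axis serves.\<close>

lemma prob_space_mvnormal:
  fixes S :: "real^'d::finite^'d"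
  assumes "pos_def_matrix S"
  shows "prob_space (mvnormal S)"
proof
  define a where "a = axis undefined (1::real) \<bullet> (S *v axis (undefined::'d) 1)"
  have a: "a > 0" using assms by (simp add: pos_def_matrix_def a_def)
  have "((1 / sqrt a) *\<^sub>R axis undefined 1) \<bullet> (S *v ((1 / sqrt a) *\<^sub>R axis undefined 1)) = 1"
    using a by (simp add: matrix_vector_mult_scaleR flip: a_def)
  from nn_integral_mvnormal_inner[OF assms this, of "\<lambda>_. 1"]
  show "emeasure (mvnormal S) (space (mvnormal S)) = 1"
    by (simp add: nn_integral_eq_integral)
qed

lemma sets_mvnormal [measurable_cong]: "sets (mvnormal S) = sets borel"
  by (simp add: mvnormal_def)

text \<open>The weight turns the standard normal density into a multiple of the centred normal
  density of variance \<open>1 / (1 + 2 * \<theta>)\<close>; this is where the lower bound on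
  \<open>\<theta>\<close> enters.\<close>

lemma nn_integral_std_normal_exp_square:
  assumes "\<theta> > - 1 / 2"
  shows "(\<integral>\<^sup>+t. ennreal (std_normal_density t) * ennreal (exp (- \<theta> * t\<^sup>2)) \<partial>lborel)
    = ennreal (1 / sqrt (1 + 2 * \<theta>))"
proof -
  define a where "a = sqrt (1 + 2 * \<theta>)"
  have a: "a > 0" "a\<^sup>2 = 1 + 2 * \<theta>" using assms by (auto simp: a_def)
  have "std_normal_density t * exp (- \<theta> * t\<^sup>2) = (1 / a) * normal_density 0 (1 / a) t" for t
  proof -
    have "t\<^sup>2 / 2 + \<theta> * t\<^sup>2 = a\<^sup>2 * t\<^sup>2 / 2" by (simp add: a algebra_simps)
    then show ?thesis using a(1)
      by (simp add: std_normal_density_def normal_density_def exp_add[symmetric] power_divide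
          real_sqrt_divide real_sqrt_mult field_simps)
  qed
  then have "(\<integral>\<^sup>+t. ennreal (std_normal_density t) * ennreal (exp (- \<theta> * t\<^sup>2)) \<partial>lborel)
      = (\<integral>\<^sup>+t. ennreal (1 / a) * ennreal (normal_density 0 (1 / a) t) \<partial>lborel)"
    using a(1) by (intro nn_integral_cong) (simp flip: ennreal_mult)
  also have "\<dots> = ennreal (1 / a)"
    using a(1) by (simp add: nn_integral_cmult nn_integral_eq_integral)
  finally show ?thesis by (simp add: a_def)
qed

subsection \<open>Tail bounds for Gaussian rows\<close>

lemma prob_space_gauss_rows:
  fixes S :: "real^'d::finite^'d"
  assumes "pos_def_matrix S"
  shows "prob_space (gauss_rows S :: ('m::finite \<Rightarrow> real^'d) measure)"
  unfolding gauss_rows_def by (intro prob_space_PiM prob_space_mvnormal assms)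

lemma measurable_gauss_rows_component:
  "(\<lambda>\<Phi>. \<Phi> i) \<in> borel_measurable (gauss_rows S :: ('m::finite \<Rightarrow> real^'d::finite) measure)"
proof -
  have "(\<lambda>\<Phi>. \<Phi> i) \<in> gauss_rows S \<rightarrow>\<^sub>M mvnormal S"
    unfolding gauss_rows_def by measurable
  then show ?thesis
    by (simp add: measurable_cong_sets[OF refl sets_mvnormal])
qed

lemma measurable_gauss_rows_inner [measurable]:
  "(\<lambda>\<Phi>. u \<bullet> \<Phi> i) \<in> borel_measurable (gauss_rows S :: ('m::finite \<Rightarrow> real^'d::finite) measure)"
  by (intro borel_measurable_inner borel_measurable_const measurable_gauss_rows_component)

text \<open>
  Negative \<open>\<theta>\<close> give the upper tail; the bound is optimal at \<open>\<theta> = (1 / c - 1) / 2\<close>.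
\<close>

lemma gauss_rows_tail:
  fixes S :: "real^'d::finite^'d" and u :: "real^'d" and \<theta> c :: real
  assumes S: "pos_def_matrix S" and u: "u \<noteq> 0" and \<theta>: "\<theta> > - 1 / 2"
  shows "measure (gauss_rows S :: ('m::finite \<Rightarrow> real^'d) measure)
      {\<Phi> \<in> space (gauss_rows S).
        \<theta> * (\<Sum>i\<in>UNIV. (u \<bullet> \<Phi> i)\<^sup>2) \<le> \<theta> * (real CARD('m) * c * (u \<bullet> (S *v u)))}
    \<le> (exp (\<theta> * c) / sqrt (1 + 2 * \<theta>)) ^ CARD('m)"
    (is "measure ?M ?A \<le> _")
proof -
  define v where "v = u \<bullet> (S *v u)"
  have v: "v > 0" using S u by (simp add: pos_def_matrix_def v_def)
  \<comment> \<open>After this normalisation each \<open>e \<bullet> \<Phi> i\<close> is a standard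
    normal variable.\<close>
  define e where "e = (1 / sqrt v) *\<^sub>R u"
  have e1: "e \<bullet> (S *v e) = 1"
    using v by (simp add: e_def matrix_vector_mult_scaleR flip: v_def)
  have eu: "(e \<bullet> x)\<^sup>2 = (u \<bullet> x)\<^sup>2 / v" for x
    using v by (simp add: e_def power_divide)
  let ?n = "CARD('m)"
  define q where "q = 1 / sqrt (1 + 2 * \<theta>)"
  interpret P: prob_space ?M by (rule prob_space_gauss_rows[OF S])
  interpret product_sigma_finite "\<lambda>_::'m. mvnormal S"
    by (simp add: product_sigma_finite_def prob_space_imp_sigma_finite prob_space_mvnormal S)
  define h where "h \<Phi> = ennreal (exp (- \<theta> * (\<Sum>i\<in>UNIV. (e \<bullet> \<Phi> i)\<^sup>2)))" for \<Phi> :: "'m \<Rightarrow> real^'d"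
  have [measurable]: "h \<in> borel_measurable ?M"
    unfolding h_def by measurable
  have "(\<integral>\<^sup>+\<Phi>. h \<Phi> \<partial>?M) = (\<integral>\<^sup>+\<Phi>. (\<Prod>i\<in>UNIV. ennreal (exp (- \<theta> * (e \<bullet> \<Phi> i)\<^sup>2))) \<partial>?M)"
    by (simp add: h_def prod_ennreal sum_distrib_left flip: exp_sum sum_negf)
  also have "\<dots> = (\<Prod>i\<in>(UNIV::'m set). \<integral>\<^sup>+x. ennreal (exp (- \<theta> * (e \<bullet> x)\<^sup>2)) \<partial>mvnormal S)"
    unfolding gauss_rows_def
  proof (rule product_nn_integral_prod)
    show "(\<lambda>x. ennreal (exp (- \<theta> * (e \<bullet> x)\<^sup>2))) \<in> borel_measurable (mvnormal S)"
      by measurable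
  qed simp
  also have "(\<integral>\<^sup>+x. ennreal (exp (- \<theta> * (e \<bullet> x)\<^sup>2)) \<partial>mvnormal S) = ennreal q"
    using nn_integral_mvnormal_inner[OF S e1, of "\<lambda>t. ennreal (exp (- \<theta> * t\<^sup>2))"]
      nn_integral_std_normal_exp_square[OF \<theta>] by (simp add: q_def)
  finally have E: "(\<integral>\<^sup>+\<Phi>. h \<Phi> \<partial>?M) = ennreal (q ^ ?n)"
    using \<theta> by (simp add: q_def ennreal_power)
  define b where "b = exp (\<theta> * (real ?n * c))"
  have [simp]: "?A \<in> sets ?M" by measurable
  \<comment> \<open>Chernoff's method: the event forces \<open>b * exp (- \<theta> * ...)\<close> to
    be at least 1, whatever the sign of \<open>\<theta>\<close>, and Markov's inequality
    applies.\<close>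
  have "emeasure ?M ?A \<le> emeasure ?M {\<Phi> \<in> space ?M. 1 \<le> ennreal b * h \<Phi>}"
  proof (rule emeasure_mono)
    show "?A \<subseteq> {\<Phi> \<in> space ?M. 1 \<le> ennreal b * h \<Phi>}"
    proof clarsimp
      fix \<Phi> :: "'m \<Rightarrow> real^'d"
      assume "\<theta> * (\<Sum>i\<in>UNIV. (u \<bullet> \<Phi> i)\<^sup>2) \<le> \<theta> * (real ?n * c * (u \<bullet> (S *v u)))"
      then have "\<theta> * (\<Sum>i\<in>UNIV. (u \<bullet> \<Phi> i)\<^sup>2) / v \<le> \<theta> * (real ?n * c * v) / v"
        using v unfolding v_def[symmetric] by (intro divide_right_mono) auto
      then have "\<theta> * (\<Sum>i\<in>UNIV. (e \<bullet> \<Phi> i)\<^sup>2) \<le> \<theta> * (real ?n * c)"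
        using v by (simp add: eu flip: sum_divide_distrib)
      then have "1 \<le> b * exp (- \<theta> * (\<Sum>i\<in>UNIV. (e \<bullet> \<Phi> i)\<^sup>2))"
        by (simp add: b_def flip: exp_add)
      then show "1 \<le> ennreal b * h \<Phi>"
        by (simp add: h_def b_def flip: ennreal_mult ennreal_1)
    qed
  qed measurable
  also have "\<dots> \<le> ennreal b * (\<integral>\<^sup>+\<Phi>. h \<Phi> * indicator (space ?M) \<Phi> \<partial>?M)"
    by (rule nn_integral_Markov_inequality) auto
  also have "(\<integral>\<^sup>+\<Phi>. h \<Phi> * indicator (space ?M) \<Phi> \<partial>?M) = (\<integral>\<^sup>+\<Phi>. h \<Phi> \<partial>?M)"
    by (intro nn_integral_cong) simp
  also have "ennreal b * \<dots> = ennreal (b * q ^ ?n)"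
    unfolding E using \<theta> by (simp add: b_def q_def ennreal_mult)
  also have "b * q ^ ?n = (exp (\<theta> * c) * q) ^ ?n"
    by (simp add: b_def power_mult_distrib exp_of_nat_mult[symmetric] ac_simps)
  finally show ?thesis
    using \<theta> by (subst (asm) P.emeasure_eq_measure) (simp add: q_def)
qed

text \<open>This is \<open>gauss_rows_tail\<close> at \<open>c = 1 / 4\<close> with the optimal
  \<open>\<theta> = 3 / 2\<close>. The strict inequality makes the event empty for
  \<open>u = 0\<close>, a case that must be allowed because sums of signed axes may cancel.\<close>

lemma gauss_rows_lower_tail:
  fixes S :: "real^'d::finite^'d"
  assumes S: "pos_def_matrix S"
  shows "measure (gauss_rows S :: ('m::finite \<Rightarrow> real^'d) measure)
      {\<Phi> \<in> space (gauss_rows S).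
        (\<Sum>i\<in>UNIV. (u \<bullet> \<Phi> i)\<^sup>2) < real CARD('m) / 4 * (u \<bullet> (S *v u))}
    \<le> exp (- real CARD('m) / 4)" (is "measure ?M ?A \<le> _")
proof (cases "u = 0")
  case True
  then show ?thesis by simp
next
  case False
  interpret P: prob_space ?M by (rule prob_space_gauss_rows[OF S])
  let ?B = "{\<Phi> \<in> space ?M. 3 / 2 * (\<Sum>i\<in>UNIV. (u \<bullet> \<Phi> i)\<^sup>2)
      \<le> 3 / 2 * (real CARD('m) * (1 / 4) * (u \<bullet> (S *v u)))}"
  have "measure ?M ?A \<le> measure ?M ?B"
    by (rule P.finite_measure_mono) auto
  also have "\<dots> \<le> (exp (3 / 2 * (1 / 4)) / sqrt (1 + 2 * (3 / 2))) ^ CARD('m)"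
    by (rule gauss_rows_tail[OF S False]) simp
  also have "\<dots> \<le> exp (- 1 / 4) ^ CARD('m)"
  proof (rule power_mono)
    \<comment> \<open>The bound needed is \<open>exp (3 / 8) / 2 \<le> exp (- 1 / 4)\<close>, which
      amounts to this inequality. Its eighth power compares \<open>exp 1 ^ 5\<close> with
      256.\<close>
    have "exp (5 / 8 :: real) \<le> 2"
    proof -
      have "exp (5 / 8 :: real) ^ 8 = exp 1 ^ 5"
        by (simp flip: exp_of_nat_mult)
      also have "\<dots> \<le> (272 / 100) ^ 5"
        using e_less_272 by (intro power_mono) auto
      also have "\<dots> \<le> 2 ^ 8" by (simp add: power_divide)
      finally show ?thesis using power_mono_iff[of "exp (5 / 8 :: real)" 2 8] by simp
    qed
    moreover have "exp (3 / 2 * (1 / 4) :: real) = exp (5 / 8) * exp (- 1 / 4)"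
      by (simp flip: exp_add)
    ultimately show "exp (3 / 2 * (1 / 4)) / sqrt (1 + 2 * (3 / 2)) \<le> exp (- 1 / 4 :: real)"
      by simp
  qed simp
  also have "\<dots> = exp (- real CARD('m) / 4)"
    by (simp flip: exp_of_nat_mult)
  finally show ?thesis .
qed

text \<open>This is \<open>gauss_rows_tail\<close> at \<open>c = 4\<close> with the optimal
  \<open>\<theta> = - 3 / 8\<close>. The square root is then 1/2, and the bound reduces to
  \<open>2 \<le> exp (5 / 4)\<close>.\<close>

lemma gauss_rows_upper_tail:
  fixes S :: "real^'d::finite^'d"
  assumes S: "pos_def_matrix S" and u: "u \<noteq> 0"
  shows "measure (gauss_rows S :: ('m::finite \<Rightarrow> real^'d) measure)
      {\<Phi> \<in> space (gauss_rows S).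
        (\<Sum>i\<in>UNIV. (u \<bullet> \<Phi> i)\<^sup>2) > 4 * real CARD('m) * (u \<bullet> (S *v u))}
    \<le> exp (- real CARD('m) / 4)" (is "measure ?M ?A \<le> _")
proof -
  interpret P: prob_space ?M by (rule prob_space_gauss_rows[OF S])
  let ?B = "{\<Phi> \<in> space ?M. - 3 / 8 * (\<Sum>i\<in>UNIV. (u \<bullet> \<Phi> i)\<^sup>2)
      \<le> - 3 / 8 * (real CARD('m) * 4 * (u \<bullet> (S *v u)))}"
  have "measure ?M ?A \<le> measure ?M ?B"
    by (rule P.finite_measure_mono) auto
  also have "\<dots> \<le> (exp (- 3 / 8 * 4) / sqrt (1 + 2 * (- 3 / 8))) ^ CARD('m)"
    by (rule gauss_rows_tail[OF S u]) simp
  also have "\<dots> \<le> exp (- 1 / 4) ^ CARD('m)"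
  proof (rule power_mono)
    have "2 \<le> exp (5 / 4 :: real)"
      using exp_ge_add_one_self[of "5 / 4"] by simp
    moreover have "exp (- 1 / 4) = exp (5 / 4) * exp (- 3 / 8 * 4 :: real)"
      by (simp flip: exp_add)
    ultimately have "exp (- 3 / 8 * 4) / (1 / 2) \<le> exp (- 1 / 4 :: real)"
      by simp
    moreover have "sqrt (1 + 2 * (- 3 / 8)) = (1 / 2 :: real)"
      by (simp add: real_sqrt_divide)
    ultimately show "exp (- 3 / 8 * 4) / sqrt (1 + 2 * (- 3 / 8)) \<le> exp (- 1 / 4 :: real)"
      by (simp only:)
  qed simp
  also have "\<dots> = exp (- real CARD('m) / 4)"
    by (simp flip: exp_of_nat_mult)
  finally show ?thesis .
qed

subsection \<open>Empirical selection\<close>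

text \<open>The averaging argument: some outcome does not exceed the expectation.\<close>

lemma weighted_average_attained:
  fixes f p :: "'i \<Rightarrow> real"
  assumes "finite I" and "\<And>i. i \<in> I \<Longrightarrow> 0 \<le> p i" and "sum p I = 1"
  shows "\<exists>i\<in>I. f i \<le> (\<Sum>j\<in>I. p j * f j)"
proof (rule ccontr)
  define a where "a = (\<Sum>j\<in>I. p j * f j)"
  assume "\<not> ?thesis"
  then have gt: "a < f i" if "i \<in> I" for i
    using that by (auto simp: a_def not_le)
  have "(\<Sum>i\<in>I. p i * (f i - a)) = 0"
    using assms(3) by (simp add: right_diff_distrib sum_subtractf a_def flip: sum_distrib_right)
  then have "p i * (f i - a) = 0" if "i \<in> I" for i
    using assms gt that by (subst (asm) sum_nonneg_eq_0_iff) (auto simp: less_imp_le)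
  with gt have "p i = 0" if "i \<in> I" for i
    using that by (metis diff_gt_0_iff_gt less_numeral_extra(3) mult_eq_0_iff)
  then have "sum p I = 0" by simp
  with assms(3) show False by simp
qed

text \<open>These are the vertices of the unit ball of the l1 norm.\<close>

definition signed_axes :: "(real^'n::finite) set" where
  "signed_axes = range (\<lambda>i. axis i 1) \<union> range (\<lambda>i. - axis i 1)"

lemma finite_signed_axes: "finite signed_axes"
  by (simp add: signed_axes_def)

lemma card_signed_axes: "card (signed_axes :: (real^'n::finite) set) \<le> 2 * CARD('n)"
proof -
  have "card (signed_axes :: (real^'n) set)
      \<le> card (range (\<lambda>i::'n. axis i (1::real))) + card (range (\<lambda>i::'n. - axis i (1::real)))"
    unfolding signed_axes_def by (rule card_Un_le)
  also have "\<dots> \<le> CARD('n) + CARD('n)"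
    by (intro add_mono card_image_le) auto
  finally show ?thesis by simp
qed

text \<open>The right-hand side is the expectation of \<open>B\<close> at \<open>z\<close> plus
  \<open>k\<close> independent random signed axes of mean \<open>x\<close>: distinct draws
  contribute \<open>B x x\<close>, each draw with itself the average over the axes. The draws are
  fixed one at a time, never raising the conditional expectation, and so \<open>z\<close> has to be
  arbitrary in the induction.\<close>

lemma empirical_selection:
  fixes B :: "real^'n::finite \<Rightarrow> real^'n \<Rightarrow> real"
  assumes B: "bilinear B" and sym: "\<And>x y. B x y = B y x" and x: "(\<Sum>i\<in>UNIV. \<bar>x $ i\<bar>) = 1"
  shows "\<exists>vs. length vs = k \<and> set vs \<subseteq> signed_axes \<and>
    B (z + sum_list vs) (z + sum_list vs) \<le> B z z + 2 * real k * B z x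
      + real k * (\<Sum>i\<in>UNIV. \<bar>x $ i\<bar> * B (axis i 1) (axis i 1)) + real k * (real k - 1) * B x x"
proof (induction k arbitrary: z)
  case 0
  show ?case by simp
next
  case (Suc k)
  define A where "A = (\<Sum>i\<in>UNIV. \<bar>x $ i\<bar> * B (axis i 1) (axis i 1))"
  \<comment> \<open>One random draw: the value \<open>\<xi> i\<close> has probability
    \<open>\<bar>x $ i\<bar>\<close>, and its sign makes the mean equal to \<open>x\<close>.\<close>
  define \<xi> :: "'n \<Rightarrow> real^'n" where "\<xi> i = (if x $ i < 0 then - axis i 1 else axis i 1)" for i
  \<comment> \<open>\<open>F w\<close> is the conditional expectation when the current sum is
    \<open>w\<close> and \<open>k\<close> draws remain.\<close>
  define F where "F w = B w w + 2 * real k * B w x + real k * A + real k * (real k - 1) * B x x" for w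
  have lin: "linear (B w)" "linear (\<lambda>v. B v w)" for w
    using B by (auto simp: bilinear_def)
  have x_eq: "x = (\<Sum>i\<in>UNIV. \<bar>x $ i\<bar> *\<^sub>R \<xi> i)"
  proof -
    have "(\<Sum>i\<in>UNIV. \<bar>x $ i\<bar> *\<^sub>R \<xi> i) = (\<Sum>i\<in>UNIV. x $ i *\<^sub>R axis i 1)"
      by (rule sum.cong) (auto simp: \<xi>_def)
    also have "\<dots> = x"
      by (simp add: vec_eq_iff axis_def if_distrib cong: if_cong)
    finally show ?thesis ..
  qed
  have avg: "(\<Sum>i\<in>UNIV. \<bar>x $ i\<bar> * B w (\<xi> i)) = B w x" for w
  proof -
    have "B w x = B w (\<Sum>i\<in>UNIV. \<bar>x $ i\<bar> *\<^sub>R \<xi> i)"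
      by (rule arg_cong[OF x_eq])
    then show ?thesis
      by (simp only: linear_sum[OF lin(1)] linear_scale[OF lin(1)] real_scaleR_def)
  qed
  have \<xi>\<xi>: "B (\<xi> i) (\<xi> i) = B (axis i 1) (axis i 1)" for i
    by (simp add: \<xi>_def linear_neg[OF lin(1)] linear_neg[OF lin(2)])
  have F: "F (z + \<xi> i) = F z + 2 * B z (\<xi> i) + B (axis i 1) (axis i 1) + 2 * real k * B x (\<xi> i)" for i
    by (simp add: F_def linear_add[OF lin(1)] linear_add[OF lin(2)] \<xi>\<xi> sym[of "\<xi> i"] algebra_simps)
  obtain i where "F (z + \<xi> i) \<le> (\<Sum>j\<in>UNIV. \<bar>x $ j\<bar> * F (z + \<xi> j))"
    using weighted_average_attained[of UNIV "\<lambda>i. \<bar>x $ i\<bar>" "\<lambda>i. F (z + \<xi> i)"] x by auto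
  also have "\<dots> = (\<Sum>j\<in>UNIV. \<bar>x $ j\<bar>) * F z + 2 * (\<Sum>j\<in>UNIV. \<bar>x $ j\<bar> * B z (\<xi> j)) + A
      + 2 * real k * (\<Sum>j\<in>UNIV. \<bar>x $ j\<bar> * B x (\<xi> j))"
    by (simp add: F A_def algebra_simps sum.distrib sum_distrib_left)
  also have "\<dots> = F z + 2 * B z x + A + 2 * real k * B x x"
    by (simp add: x avg)
  also have "\<dots> = B z z + 2 * real (Suc k) * B z x + real (Suc k) * A
      + real (Suc k) * (real (Suc k) - 1) * B x x"
    by (simp add: F_def algebra_simps)
  finally have Fi: "F (z + \<xi> i) \<le> \<dots>" .
  obtain vs where "length vs = k" "set vs \<subseteq> signed_axes"
    and "B (z + \<xi> i + sum_list vs) (z + \<xi> i + sum_list vs) \<le> F (z + \<xi> i)"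
    using Suc.IH[of "z + \<xi> i"] unfolding F_def A_def by blast
  with Fi show ?case
    unfolding A_def[symmetric]
    by (intro exI[of _ "\<xi> i # vs"]) (auto simp: \<xi>_def signed_axes_def add.assoc)
qed

subsection \<open>Eigenvalues and the condition number\<close>

text \<open>The quadratic form attains its maximum on the compact unit sphere, and the first
  variation at a maximiser \<open>v\<close> shows that \<open>v\<close> is an eigenvector.\<close>

lemma symmetric_matrix_max_eigenvalue:
  fixes S :: "real^'d::finite^'d"
  assumes "transpose S = S"
  obtains v \<mu> where "v \<noteq> 0" and "S *v v = \<mu> *\<^sub>R v" and "\<And>x. x \<bullet> (S *v x) \<le> \<mu> * (norm x)\<^sup>2"
proof -
  have sym: "x \<bullet> (S *v y) = y \<bullet> (S *v x)" for x y
    by (metis assms inner_commute symmetric_matrix_inner)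
  have "\<exists>v\<in>sphere 0 1. \<forall>x\<in>sphere 0 1. x \<bullet> (S *v x) \<le> v \<bullet> (S *v v)"
  proof (rule continuous_attains_sup)
    show "sphere (0::real^'d) 1 \<noteq> {}"
      using norm_axis_1 by (auto simp: set_eq_iff intro!: exI[of _ "axis undefined 1"])
    show "continuous_on (sphere 0 1) (\<lambda>x. x \<bullet> (S *v x))"
      by (intro continuous_intros matrix_vector_mult_linear_continuous_on)
  qed simp
  then obtain v where v: "norm v = 1" and max: "\<And>x. norm x = 1 \<Longrightarrow> x \<bullet> (S *v x) \<le> v \<bullet> (S *v v)"
    by auto
  define \<mu> where "\<mu> = v \<bullet> (S *v v)"
  have le: "x \<bullet> (S *v x) \<le> \<mu> * (norm x)\<^sup>2" for x
  proof (cases "x = 0")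
    case False
    define y where "y = (1 / norm x) *\<^sub>R x"
    have "norm y = 1" using False by (simp add: y_def)
    from max[OF this] have "y \<bullet> (S *v y) \<le> \<mu>" by (simp add: \<mu>_def)
    moreover have "x = norm x *\<^sub>R y" using False by (simp add: y_def)
    then have "x \<bullet> (S *v x) = (norm x)\<^sup>2 * (y \<bullet> (S *v y))"
      by (metis inner_scaleR_left inner_scaleR_right matrix_vector_mult_scaleR mult.assoc power2_eq_square)
    ultimately show ?thesis
      by (simp add: mult.commute mult_right_mono)
  qed simp
  \<comment> \<open>The residual \<open>w\<close> is the direction of variation; the goal is that it
    vanishes.\<close>
  define w where "w = \<mu> *\<^sub>R v - S *v v"
  define b where "b = w \<bullet> w"
  define c where "c = \<mu> * (w \<bullet> w) - w \<bullet> (S *v w)"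
  have c: "c \<ge> 0" using le[of w] by (simp add: c_def power2_norm_eq_inner)
  have q: "0 \<le> 2 * t * b + t\<^sup>2 * c" for t
  proof -
    have "0 \<le> \<mu> * ((v + t *\<^sub>R w) \<bullet> (v + t *\<^sub>R w)) - (v + t *\<^sub>R w) \<bullet> (S *v (v + t *\<^sub>R w))"
      using le[of "v + t *\<^sub>R w"] by (simp add: power2_norm_eq_inner)
    also have "\<dots> = (\<mu> * (v \<bullet> v) - v \<bullet> (S *v v)) + 2 * t * (\<mu> * (w \<bullet> v) - w \<bullet> (S *v v)) + t\<^sup>2 * c"
      by (simp add: c_def inner_add_left inner_add_right matrix_vector_right_distrib
          matrix_vector_mult_scaleR sym[of v w] inner_commute[of v w] power2_eq_square algebra_simps)
    also have "\<mu> * (v \<bullet> v) - v \<bullet> (S *v v) = 0"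
      using v by (simp add: \<mu>_def flip: power2_norm_eq_inner)
    also have "\<mu> * (w \<bullet> v) - w \<bullet> (S *v v) = b"
      by (simp add: b_def) (simp add: w_def inner_diff_right)
    finally show ?thesis by simp
  qed
  have "b = 0"
  proof (rule ccontr)
    assume "b \<noteq> 0"
    then have b: "b > 0" by (simp add: b_def)
    \<comment> \<open>At \<open>t = - r\<close> the linear term outweighs the quadratic one. The
      summand 1 keeps the denominator positive when \<open>c = 0\<close>.\<close>
    define r where "r = b / (c + 1)"
    have r: "r > 0" "b = r * (c + 1)" using b c by (simp_all add: r_def)
    have "2 * (- r) * b + (- r)\<^sup>2 * c = - (r\<^sup>2 * (c + 2))"
      unfolding r(2) by (simp add: algebra_simps power2_eq_square)
    also have "\<dots> < 0"
      using r(1) c by simp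
    finally show False using q[of "- r"] by simp
  qed
  then have "S *v v = \<mu> *\<^sub>R v" by (simp add: b_def w_def)
  moreover have "v \<noteq> 0" using v by auto
  ultimately show ?thesis using le that by blast
qed

text \<open>Eigenvectors for distinct eigenvalues are orthogonal, hence independent. Finiteness
  gives \<open>Max\<close> and \<open>Min\<close> in \<open>cond_number\<close> their intended
  meaning.\<close>

lemma finite_symmetric_eigenvalues:
  fixes N :: "real^'d::finite^'d"
  assumes "transpose N = N"
  shows "finite {\<mu>. \<exists>v. v \<noteq> 0 \<and> N *v v = \<mu> *\<^sub>R v}"
proof -
  define E where "E = {\<mu>. \<exists>v. v \<noteq> 0 \<and> N *v v = \<mu> *\<^sub>R v}"
  define f where "f \<mu> = (SOME v. v \<noteq> 0 \<and> N *v v = \<mu> *\<^sub>R v)" for \<mu>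
  have f: "f \<mu> \<noteq> 0" "N *v f \<mu> = \<mu> *\<^sub>R f \<mu>" if "\<mu> \<in> E" for \<mu>
    using that someI_ex[of "\<lambda>v. v \<noteq> 0 \<and> N *v v = \<mu> *\<^sub>R v"] unfolding E_def f_def by blast+
  have orth: "f \<mu> \<bullet> f \<nu> = 0" if "\<mu> \<in> E" "\<nu> \<in> E" "\<mu> \<noteq> \<nu>" for \<mu> \<nu>
  proof -
    have "f \<mu> \<bullet> (N *v f \<nu>) = (N *v f \<mu>) \<bullet> f \<nu>"
      by (rule symmetric_matrix_inner[OF assms])
    then have "\<nu> * (f \<mu> \<bullet> f \<nu>) = \<mu> * (f \<mu> \<bullet> f \<nu>)"
      by (simp only: f(2)[OF that(1)] f(2)[OF that(2)] inner_scaleR_left inner_scaleR_right)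
    then show ?thesis using that(3) by simp
  qed
  have inj: "inj_on f E"
  proof (rule inj_onI, rule ccontr)
    fix \<mu> \<nu> assume *: "\<mu> \<in> E" "\<nu> \<in> E" "f \<mu> = f \<nu>" "\<mu> \<noteq> \<nu>"
    then show False using orth[OF *(1,2,4)] f(1)[OF *(2)] by simp
  qed
  have "independent (f ` E)"
  proof (rule pairwise_orthogonal_independent)
    show "pairwise orthogonal (f ` E)"
    proof (rule pairwise_imageI)
      fix \<mu> \<nu> assume "\<mu> \<in> E" "\<nu> \<in> E" "\<mu> \<noteq> \<nu>"
      then show "orthogonal (f \<mu>) (f \<nu>)" by (simp add: orthogonal_def orth)
    qed
    show "0 \<notin> f ` E" using f(1) by (metis imageE)
  qed
  then have "finite (f ` E)" by (rule independent_imp_finite)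
  then have "finite E" using inj by (rule finite_imageD)
  then show ?thesis by (simp only: E_def)
qed

text \<open>\<open>b\<close> is the largest eigenvalue of \<open>S\<close>, and \<open>a\<close> is
  minus the largest eigenvalue of \<open>- S\<close>. For the bound on \<open>b / a\<close> it is
  enough that both are singular values.\<close>

lemma pos_def_matrix_cond_number:
  fixes S :: "real^'d::finite^'d"
  assumes S: "pos_def_matrix S"
  obtains a b where "0 < a" and "a \<le> b" and "b / a \<le> cond_number S"
    and "\<And>x. a * (norm x)\<^sup>2 \<le> x \<bullet> (S *v x)" and "\<And>x. x \<bullet> (S *v x) \<le> b * (norm x)\<^sup>2"
proof -
  have T: "transpose S = S" and pos: "\<And>x. x \<noteq> 0 \<Longrightarrow> x \<bullet> (S *v x) > 0"
    using S by (auto simp: pos_def_matrix_def)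
  obtain v b where v: "v \<noteq> 0" "S *v v = b *\<^sub>R v" and b: "\<And>x. x \<bullet> (S *v x) \<le> b * (norm x)\<^sup>2"
    using symmetric_matrix_max_eigenvalue[OF T] by blast
  have "transpose (- S) = - S" using T by (simp add: transpose_def vec_eq_iff)
  then obtain w a' where w: "w \<noteq> 0" "(- S) *v w = a' *\<^sub>R w"
      and a': "\<And>x. x \<bullet> ((- S) *v x) \<le> a' * (norm x)\<^sup>2"
    using symmetric_matrix_max_eigenvalue by blast
  define a where "a = - a'"
  have neg: "(- S) *v x = - (S *v x)" for x
    by (simp add: matrix_vector_mult_def vec_eq_iff sum_negf)
  have w': "S *v w = a *\<^sub>R w" using w(2) neg[of w] by (simp add: a_def) (metis minus_minus)
  have a: "a * (norm x)\<^sup>2 \<le> x \<bullet> (S *v x)" for x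
    using a'[of x] by (simp add: neg a_def)
  have "0 < w \<bullet> (S *v w)" by (rule pos) fact
  then have "0 < a * (w \<bullet> w)" by (simp only: w' inner_scaleR_right)
  then have a0: "0 < a" using w(1) by (intro zero_less_mult_pos2[of a "w \<bullet> w"]) auto
  have "a * (norm w)\<^sup>2 \<le> b * (norm w)\<^sup>2" using a[of w] b[of w] by simp
  then have ab: "a \<le> b" using w(1) by simp
  let ?E = "{\<mu>. \<exists>v. v \<noteq> 0 \<and> (transpose S ** S) *v v = \<mu> *\<^sub>R v}"
  have sv: "singular_values S = sqrt ` ?E"
    by (auto simp: singular_values_def)
  have fin: "finite (singular_values S)"
    unfolding sv by (intro finite_imageI finite_symmetric_eigenvalues) (simp add: matrix_transpose_mul)
  have mem: "\<mu> \<in> singular_values S" if "u \<noteq> 0" "S *v u = \<mu> *\<^sub>R u" "\<mu> \<ge> 0" for u \<mu>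
  proof -
    have "(transpose S ** S) *v u = \<mu>\<^sup>2 *\<^sub>R u"
      using that by (simp add: T matrix_vector_mult_scaleR power2_eq_square flip: matrix_vector_mul_assoc)
    then have "\<mu>\<^sup>2 \<in> ?E" using that by blast
    then have "sqrt (\<mu>\<^sup>2) \<in> sqrt ` ?E" by (rule imageI)
    then show ?thesis using that by (simp add: sv)
  qed
  have sa: "a \<in> singular_values S" and sb: "b \<in> singular_values S"
    using mem[OF w(1) w'] mem[OF v] a0 ab by auto
  \<comment> \<open>Positivity of the smallest singular value is needed for the comparison of
    quotients in \<open>frac_le\<close>.\<close>
  have "t > 0" if "t \<in> singular_values S" for t
  proof -
    obtain \<mu> u where u: "t = sqrt \<mu>" "u \<noteq> 0" "(transpose S ** S) *v u = \<mu> *\<^sub>R u"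
      using \<open>t \<in> singular_values S\<close> by (auto simp: singular_values_def)
    have "S *v u \<noteq> 0" using pos[OF u(2)] by auto
    then have "0 < (S *v u) \<bullet> (S *v u)" by simp
    also have "\<dots> = u \<bullet> (S *v (S *v u))"
      by (rule symmetric_matrix_inner[OF T, symmetric])
    also have "\<dots> = \<mu> * (u \<bullet> u)"
      using u(3) by (simp add: T flip: matrix_vector_mul_assoc)
    finally have "0 < \<mu>" using u(2) by (intro zero_less_mult_pos2[of \<mu> "u \<bullet> u"]) auto
    then show ?thesis using u(1) by simp
  qed
  then have "0 < Min (singular_values S)"
    using fin sa Min_in by blast
  moreover have "Min (singular_values S) \<le> a" "b \<le> Max (singular_values S)"
    using fin sa sb by auto
  ultimately have "b / a \<le> cond_number S"
    unfolding cond_number_def using a0 ab by (intro frac_le) auto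
  with a0 ab a b show ?thesis using that by blast
qed

subsection \<open>The null space property\<close>

lemma closed_l1_cone:
  "closed {x::real^'n::finite. \<exists>T. card T \<le> s \<and> l1_on (- T) x \<le> l1_on T x}"
proof -
  have "closed {x::real^'n. l1_on (- T) x \<le> l1_on T x}" for T
    unfolding l1_on_def by (intro closed_Collect_le continuous_intros)
  then have "closed (\<Union>T\<in>{T. card T \<le> s}. {x::real^'n. l1_on (- T) x \<le> l1_on T x})"
    by (intro closed_UN) auto
  moreover have "(\<Union>T\<in>{T. card T \<le> s}. {x::real^'n. l1_on (- T) x \<le> l1_on T x})
      = {x. \<exists>T. card T \<le> s \<and> l1_on (- T) x \<le> l1_on T x}"
    by auto
  ultimately show ?thesis by simp
qed

text \<open>A violation is invariant under scaling, so it may be sought on the compact unit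
  sphere.\<close>

lemma null_space_property_iff_sphere:
  fixes A :: "real^'n::finite^'k::finite"
  shows "null_space_property A s \<longleftrightarrow>
    \<not> (\<exists>x. norm x = 1 \<and> (\<exists>T. card T \<le> s \<and> l1_on (- T) x \<le> l1_on T x) \<and> A *v x = 0)"
proof -
  have "\<exists>y. norm y = 1 \<and> (\<exists>T. card T \<le> s \<and> l1_on (- T) y \<le> l1_on T y) \<and> A *v y = 0"
    if x: "A *v x = 0" "x \<noteq> 0" and T: "card T \<le> s" "l1_on (- T) x \<le> l1_on T x" for x T
  proof -
    define y where "y = (1 / norm x) *\<^sub>R x"
    have "l1_on U y = l1_on U x / norm x" for U
      by (simp add: l1_on_def y_def abs_mult sum_divide_distrib)
    then have "l1_on (- T) y \<le> l1_on T y"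
      using T(2) by (simp add: divide_right_mono)
    moreover have "norm y = 1" "A *v y = 0"
      using x by (simp_all add: y_def matrix_vector_mult_scaleR)
    ultimately show ?thesis using T(1) by blast
  qed
  then show ?thesis
    unfolding null_space_property_def by (fastforce simp: not_less)
qed

text \<open>The matrices that fail are the projection of a closed set along a compact factor, hence
  closed. Measurability of the event in the theorem follows from this.\<close>

lemma open_null_space_property:
  fixes D :: "real^'n::finite^'d::finite"
  shows "open {A :: real^'d^'m::finite. null_space_property (A ** D) s}"
proof -
  let ?K = "sphere 0 1 \<inter> {x::real^'n. \<exists>T. card T \<le> s \<and> l1_on (- T) x \<le> l1_on T x}"
  let ?C = "{p :: (real^'n) \<times> (real^'d^'m). snd p *v (D *v fst p) = 0}"
  have "closed ?C"
    unfolding matrix_vector_mult_def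
    by (intro closed_Collect_eq continuous_on_vec_lambda continuous_intros)
  moreover have "compact ?K"
    by (intro compact_Int_closed closed_l1_cone) simp
  ultimately have "closed {A. \<exists>x. x \<in> ?K \<and> (x, A) \<in> ?C}"
    by (intro closed_compact_projection)
  moreover have "{A :: real^'d^'m. null_space_property (A ** D) s} = - {A. \<exists>x. x \<in> ?K \<and> (x, A) \<in> ?C}"
    by (auto simp: null_space_property_iff_sphere matrix_vector_mul_assoc)
  ultimately show ?thesis by (simp add: open_Compl)
qed

section \<open>A deterministic criterion for the null space property\<close>

lemma l1_on_square_le:
  "(l1_on T x)\<^sup>2 \<le> real (card T) * (norm x)\<^sup>2"
proof -
  have "(l1_on T x)\<^sup>2 \<le> (\<Sum>i\<in>T. \<bar>x $ i\<bar>\<^sup>2) * real (card T)"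
    unfolding l1_on_def by (rule sum_squared_le_sum_of_squares)
  also have "(\<Sum>i\<in>T. \<bar>x $ i\<bar>\<^sup>2) \<le> (\<Sum>i\<in>UNIV. \<bar>x $ i\<bar>\<^sup>2)"
    by (rule sum_mono2) auto
  also have "(\<Sum>i\<in>UNIV. \<bar>x $ i\<bar>\<^sup>2) = (norm x)\<^sup>2"
    by (simp add: power2_norm_vec)
  finally show ?thesis by (simp add: mult.commute mult_right_mono)
qed

text \<open>On the cone the part on \<open>T\<close> carries at least half of the l1 norm, and
  Cauchy-Schwarz bounds that part.\<close>

lemma l1_cone_square_le:
  fixes x :: "real^'n::finite"
  assumes "card T \<le> s" and "l1_on (- T) x \<le> l1_on T x"
  shows "(\<Sum>i\<in>UNIV. \<bar>x $ i\<bar>)\<^sup>2 \<le> 4 * real s * (norm x)\<^sup>2"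
proof -
  have nn: "0 \<le> l1_on U x" for U by (simp add: l1_on_def sum_nonneg)
  have "(\<Sum>i\<in>UNIV. \<bar>x $ i\<bar>) = l1_on T x + l1_on (- T) x"
    unfolding l1_on_def by (subst sum.union_disjoint[symmetric]) auto
  then have "(\<Sum>i\<in>UNIV. \<bar>x $ i\<bar>)\<^sup>2 \<le> (2 * l1_on T x)\<^sup>2"
    using assms(2) nn[of T] nn[of "- T"] by (intro power_mono) auto
  also have "\<dots> \<le> 4 * (real (card T) * (norm x)\<^sup>2)"
    using l1_on_square_le[of T x] by (simp add: power_mult_distrib)
  also have "\<dots> \<le> 4 * (real s * (norm x)\<^sup>2)"
    using assms(1) by (intro mult_left_mono mult_right_mono) auto
  finally show ?thesis by simp
qed

text \<open>In the application \<open>R z w\<close> is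
  \<open>(D *v z) \<bullet> (\<Sigma> *v (D *v w))\<close> and \<open>c\<close> is
  \<open>m/4\<close>. The condition on \<open>k\<close> says that the negative contribution of a
  normalised kernel vector, at least \<open>(k - 1) * c * r / (4 * s)\<close> in size, outweighs the
  column bound \<open>h\<close>.\<close>

lemma null_space_property_if_lower_bound:
  fixes A :: "real^'n::finite^'k::finite" and R :: "real^'n \<Rightarrow> real^'n \<Rightarrow> real"
  assumes R: "bilinear R" "\<And>x y. R x y = R y x" "\<And>x. 0 \<le> R x x"
    and c: "0 \<le> c"
    and sparse: "\<And>vs. length vs = k \<Longrightarrow> set vs \<subseteq> signed_axes \<Longrightarrow>
      c * R (sum_list vs) (sum_list vs) \<le> (norm (A *v sum_list vs))\<^sup>2"
    and cols: "\<And>i. (norm (A *v axis i 1))\<^sup>2 \<le> h"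
    and cone: "\<And>x T. norm x = 1 \<Longrightarrow> card T \<le> s \<Longrightarrow> l1_on (- T) x \<le> l1_on T x \<Longrightarrow> r \<le> R x x"
    and k: "4 * real s * h < (real k - 1) * (c * r)" "1 \<le> k"
  shows "null_space_property A s"
  unfolding null_space_property_iff_sphere
proof clarify
  fix x T
  assume x: "norm x = 1" "A *v x = 0" and T: "card T \<le> s" "l1_on (- T) x \<le> l1_on T x"
  define t where "t = (\<Sum>i\<in>UNIV. \<bar>x $ i\<bar>)"
  have "norm x \<le> t" unfolding t_def by (rule norm_le_l1_cart)
  then have t: "t \<ge> 1" using x by simp
  have t2: "t\<^sup>2 \<le> 4 * real s"
    using l1_cone_square_le[OF T] x by (simp add: t_def)
  define y where "y = (1 / t) *\<^sub>R x"
  have y1: "(\<Sum>i\<in>UNIV. \<bar>y $ i\<bar>) = 1"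
    using t by (simp add: y_def abs_mult t_def flip: sum_divide_distrib)
  \<comment> \<open>The polarised form of \<open>q\<close> from the outline, for general
    \<open>R\<close> and \<open>c\<close>.\<close>
  define B where "B z w = (A *v z) \<bullet> (A *v w) - c * R z w" for z w
  have lin: "linear (R w)" "linear (\<lambda>v. R v w)" for w
    using R(1) by (auto simp: bilinear_def)
  have B: "bilinear B"
    unfolding bilinear_def B_def
    by (auto intro!: linearI simp: linear_add[OF lin(1)] linear_add[OF lin(2)]
        linear_scale[OF lin(1)] linear_scale[OF lin(2)] matrix_vector_right_distrib
        matrix_vector_mult_scaleR inner_add_left inner_add_right algebra_simps)
  have Bsym: "B z w = B w z" for z w
    by (simp add: B_def inner_commute R(2)[of z w])
  \<comment> \<open>Starting the selection at 0 removes the first two terms of the bound.\<close>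
  obtain vs where vs: "length vs = k" "set vs \<subseteq> signed_axes"
    and le: "B (sum_list vs) (sum_list vs) \<le> B 0 0 + 2 * real k * B 0 y
      + real k * (\<Sum>i\<in>UNIV. \<bar>y $ i\<bar> * B (axis i 1) (axis i 1)) + real k * (real k - 1) * B y y"
    using empirical_selection[OF B Bsym y1, of k 0] by auto
  have B0: "B 0 0 = 0" "B 0 y = 0"
    using B by (simp_all add: bilinear_lzero)
  \<comment> \<open>Since \<open>A *v x = 0\<close>, only the subtracted term of \<open>B\<close>
    survives.\<close>
  have Byy: "B y y = - (c * R x x) / t\<^sup>2"
    using x t by (simp add: B_def y_def matrix_vector_mult_scaleR linear_scale[OF lin(1)]
        linear_scale[OF lin(2)] power2_eq_square)
  have "(\<Sum>i\<in>UNIV. \<bar>y $ i\<bar> * B (axis i 1) (axis i 1)) \<le> (\<Sum>i\<in>UNIV. \<bar>y $ i\<bar> * h)"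
  proof (intro sum_mono mult_left_mono)
    fix i
    show "B (axis i 1) (axis i 1) \<le> h"
      using cols[of i] mult_nonneg_nonneg[OF c R(3)[of "axis i 1"]]
      by (simp add: B_def power2_norm_eq_inner)
  qed simp
  also have "\<dots> = h"
    using y1 by (simp flip: sum_distrib_right)
  finally have avg: "(\<Sum>i\<in>UNIV. \<bar>y $ i\<bar> * B (axis i 1) (axis i 1)) \<le> h" .
  have "0 \<le> B (sum_list vs) (sum_list vs)"
    using sparse[OF vs] by (simp add: B_def power2_norm_eq_inner)
  also have "\<dots> \<le> real k * (\<Sum>i\<in>UNIV. \<bar>y $ i\<bar> * B (axis i 1) (axis i 1))
      + real k * (real k - 1) * B y y"
    using le by (simp add: B0)
  also have "\<dots> \<le> real k * h + real k * (real k - 1) * B y y"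
    using avg by (intro add_right_mono mult_left_mono) auto
  also have "\<dots> = real k * (h - (real k - 1) * (c * R x x) / t\<^sup>2)"
    unfolding Byy by (simp add: algebra_simps)
  finally have "0 \<le> real k * (h - (real k - 1) * (c * R x x) / t\<^sup>2)" .
  then have "(real k - 1) * (c * R x x) \<le> h * t\<^sup>2"
    using k(2) t by (simp add: zero_le_mult_iff divide_le_eq)
  moreover have "(real k - 1) * (c * r) \<le> (real k - 1) * (c * R x x)"
    using cone[OF x(1) T] c k(2) by (intro mult_left_mono) auto
  moreover have "h * t\<^sup>2 \<le> h * (4 * real s)"
    using t2 order_trans[OF zero_le_power2 cols] by (intro mult_left_mono) auto
  ultimately show False using k(1) by (simp add: mult.commute mult.left_commute)
qed

section \<open>Gaussian rows and the union bound\<close>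

lemma rows_matrix_norm_square:
  fixes D :: "real^'n::finite^'d::finite" and \<Phi> :: "'m::finite \<Rightarrow> real^'d"
  shows "(norm ((rows_matrix \<Phi> ** D) *v z))\<^sup>2 = (\<Sum>i\<in>UNIV. ((D *v z) \<bullet> \<Phi> i)\<^sup>2)"
proof -
  have "(rows_matrix \<Phi> *v w) $ i = w \<bullet> \<Phi> i" for w i
    by (simp add: rows_matrix_def matrix_vector_mult_def inner_vec_def mult.commute)
  then show ?thesis
    by (simp add: power2_norm_vec flip: matrix_vector_mul_assoc)
qed

lemma sets_null_space_property:
  fixes D :: "real^'n::finite^'d::finite" and S :: "real^'d^'d"
  shows "{\<Phi> \<in> space (gauss_rows S :: ('m::finite \<Rightarrow> real^'d) measure).
    null_space_property (rows_matrix \<Phi> ** D) s} \<in> sets (gauss_rows S)"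
proof -
  have "rows_matrix \<in> borel_measurable (gauss_rows S :: ('m \<Rightarrow> real^'d) measure)"
    unfolding rows_matrix_def
    by (intro borel_measurable_vec_lambda measurable_gauss_rows_component)
  from measurable_sets[OF this borel_open[OF open_null_space_property[of D s]]]
  show ?thesis by (simp add: vimage_def Int_def conj_commute)
qed

lemma norm_ge_on_S_gamma:
  assumes "\<eta> \<le> (INF x\<in>S_gamma s \<gamma>. norm (D *v x))" and "x \<in> S_gamma s \<gamma>"
  shows "\<eta> \<le> norm (D *v x)"
  by (rule order_trans[OF assms(1) cINF_lower[OF bdd_belowI2[of _ 0] assms(2)]]) simp

text \<open>With \<open>T = {i}\<close> the tail vanishes. Consequently every column of
  \<open>D\<close> has norm at least \<open>\<eta>\<close>, which makes the columns nonzero and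
  yields \<open>\<eta>\<^sup>2 \<le> \<rho>\<close>.\<close>

lemma axis_in_S_gamma:
  assumes "1 \<le> s"
  shows "axis i 1 \<in> S_gamma s \<gamma>"
proof -
  have "l1_on {i} (axis i 1) = 1" "l1_on (- {i}) (axis i 1) = 0"
    by (simp_all add: l1_on_def axis_def)
  then show ?thesis
    using assms by (auto simp: S_gamma_def norm_axis_1 intro!: exI[of _ "{i}"])
qed

theorem theorem5p1:
  fixes s :: nat and \<gamma> \<eta> \<rho> :: real
    and \<Sigma> :: "real^'d::finite^'d"
    and D :: "real^'n::finite^'d"
  assumes "1 \<le> s" and "s \<le> CARD('n)"
    and "0 < \<gamma>" and "\<gamma> < 1"
    and "pos_def_matrix \<Sigma>"
    and "\<eta> > 0"
    and "(INF x\<in>S_gamma s \<gamma>. norm (D *v x)) \<ge> \<eta>"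
    and "\<forall>i. (norm (column i D))\<^sup>2 \<le> \<rho>"
    and "real CARD('m::finite) \<ge> (18 * 2^9 * pi * exp 1 / \<eta>\<^sup>2) * (\<rho> * cond_number \<Sigma> / \<gamma>\<^sup>2)
                  * real s * ln (2 * real CARD('n))"
  shows "measure (gauss_rows \<Sigma> :: ('m \<Rightarrow> real^'d) measure)
            {\<Phi> \<in> space (gauss_rows \<Sigma>). null_space_property (rows_matrix \<Phi> ** D) s}
         \<ge> 1 - exp (- real CARD('m) / (128 * exp 1 * pi))"
proof -
  let ?M = "gauss_rows \<Sigma> :: ('m \<Rightarrow> real^'d) measure"
  let ?m = "real CARD('m)" and ?N = "2 * real CARD('n)"
  interpret P: prob_space ?M by (rule prob_space_gauss_rows) fact
  obtain a b where ab: "0 < a" "a \<le> b" and \<kappa>: "b / a \<le> cond_number \<Sigma>"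
    and lo: "\<And>x. a * (norm x)\<^sup>2 \<le> x \<bullet> (\<Sigma> *v x)" and up: "\<And>x. x \<bullet> (\<Sigma> *v x) \<le> b * (norm x)\<^sup>2"
    using pos_def_matrix_cond_number[OF assms(5)] by blast
  note ge = norm_ge_on_S_gamma[OF assms(7)]
  have col: "D *v axis i 1 = column i D" for i
    by (rule matrix_vector_mult_basis)
  have col_ge: "\<eta> \<le> norm (D *v axis i 1)" for i
    by (rule ge[OF axis_in_S_gamma]) fact
  have \<eta>\<rho>: "\<eta>\<^sup>2 \<le> \<rho>"
  proof -
    have "\<eta>\<^sup>2 \<le> (norm (D *v axis undefined 1))\<^sup>2"
      using col_ge assms(6) by (intro power_mono) auto
    also have "\<dots> \<le> \<rho>" using assms(8) by (simp add: col)
    finally show ?thesis .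
  qed
  \<comment> \<open>The sample bound without its logarithm, the factor \<open>\<gamma>\<close> and
    the numerical constants. The facts that follow give \<open>X \<ge> 1\<close>, so rounding errors
    can be absorbed into multiples of \<open>X\<close>.\<close>
  define X where "X = real s * (\<rho> / \<eta>\<^sup>2) * cond_number \<Sigma>"
  have \<kappa>1: "1 \<le> cond_number \<Sigma>"
    by (rule order_trans[OF _ \<kappa>]) (use ab in simp)
  have "1 \<le> \<rho> / \<eta>\<^sup>2" using \<eta>\<rho> assms(6) by simp
  then have s\<rho>: "1 \<le> real s * (\<rho> / \<eta>\<^sup>2)"
    using mult_mono[of 1 "real s" 1 "\<rho> / \<eta>\<^sup>2"] assms(1) by simp
  then have X1: "1 \<le> X"
    using mult_mono[of 1 "real s * (\<rho> / \<eta>\<^sup>2)" 1 "cond_number \<Sigma>"] \<kappa>1 by (simp add: X_def)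
  have Xge: "real s * (\<rho> / \<eta>\<^sup>2) * (b / a) \<le> X"
    unfolding X_def using \<kappa> s\<rho> by (intro mult_left_mono) auto
  \<comment> \<open>With \<open>h = 4 m b \<rho>\<close>, \<open>c = m/4\<close> and
    \<open>r = a \<eta>\<^sup>2\<close> the criterion requires \<open>k - 1\<close> to exceed 64
    times \<open>s \<rho> b / (\<eta>\<^sup>2 a)\<close>, which is at most \<open>X\<close>. Adding
    2 rather than 1 makes the inequality strict after rounding down.\<close>
  define k where "k = nat \<lfloor>64 * X\<rfloor> + 2"
  have k: "real k \<le> 64 * X + 2" "64 * X < real k - 1"
    using X1 by (auto simp: k_def) linarith+
  define R where "R z w = (D *v z) \<bullet> (\<Sigma> *v (D *v w))" for z w
  have \<Sigma>sym: "transpose \<Sigma> = \<Sigma>" using assms(5) by (simp add: pos_def_matrix_def)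
  have R: "bilinear R" "\<And>z w. R z w = R w z" "\<And>z. 0 \<le> R z z"
  proof -
    show "bilinear R"
      unfolding bilinear_def R_def
      by (auto intro!: linearI simp: matrix_vector_right_distrib
          matrix_vector_mult_scaleR inner_add_left inner_add_right)
    show "R z w = R w z" for z w
      unfolding R_def by (metis \<Sigma>sym symmetric_matrix_inner inner_commute)
    show "0 \<le> R z z" for z
      unfolding R_def by (rule order_trans[OF _ lo]) (use ab in simp)
  qed
  define U :: "(real^'n) set"
    where "U = sum_list ` {vs. set vs \<subseteq> signed_axes \<and> length vs = k}"
  have finU: "finite U"
    unfolding U_def by (intro finite_imageI finite_lists_length_eq finite_signed_axes)
  have cardU: "real (card U) \<le> ?N ^ k"
  proof -
    have "card U \<le> card {vs :: (real^'n) list. set vs \<subseteq> signed_axes \<and> length vs = k}"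
      unfolding U_def by (intro card_image_le finite_lists_length_eq finite_signed_axes)
    also have "\<dots> = card (signed_axes :: (real^'n) set) ^ k"
      by (rule card_lists_length_eq) (rule finite_signed_axes)
    also have "\<dots> \<le> (2 * CARD('n)) ^ k"
      by (intro power_mono card_signed_axes) simp
    finally have "real (card U) \<le> real ((2 * CARD('n)) ^ k)" by (simp only: of_nat_le_iff)
    then show ?thesis by simp
  qed
  \<comment> \<open>The bad events: \<open>q\<close> is negative at a point of \<open>U\<close>, or,
    in \<open>H\<close>, a column of the product is too long.\<close>
  define L where "L u = {\<Phi> \<in> space ?M. (\<Sum>i\<in>UNIV. ((D *v u) \<bullet> \<Phi> i)\<^sup>2) < ?m / 4 * R u u}" for u
  define H where "H i = {\<Phi> \<in> space ?M. (\<Sum>j\<in>UNIV. ((D *v axis i 1) \<bullet> \<Phi> j)\<^sup>2)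
      > 4 * ?m * R (axis i 1) (axis i 1)}" for i
  have L: "L u \<in> sets ?M" "measure ?M (L u) \<le> exp (- ?m / 4)" for u
    unfolding L_def R_def using gauss_rows_lower_tail[OF assms(5), of "D *v u"] by measurable
  have H: "H i \<in> sets ?M" "measure ?M (H i) \<le> exp (- ?m / 4)" for i
  proof -
    have "D *v axis i 1 \<noteq> 0" using col_ge[of i] assms(6) by auto
    from gauss_rows_upper_tail[OF assms(5) this] show "measure ?M (H i) \<le> exp (- ?m / 4)"
      by (simp add: H_def R_def)
    show "H i \<in> sets ?M" unfolding H_def by measurable
  qed
  define Good where "Good = {\<Phi> \<in> space ?M. null_space_property (rows_matrix \<Phi> ** D) s}"
  have Good: "Good \<in> sets ?M" unfolding Good_def by (rule sets_null_space_property)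
  have sub: "space ?M - Good \<subseteq> (\<Union>u\<in>U. L u) \<union> (\<Union>i. H i)"
  proof (rule subsetI, rule ccontr)
    fix \<Phi> assume \<Phi>: "\<Phi> \<in> space ?M - Good" "\<Phi> \<notin> (\<Union>u\<in>U. L u) \<union> (\<Union>i. H i)"
    have "null_space_property (rows_matrix \<Phi> ** D) s"
    proof (rule null_space_property_if_lower_bound[OF R, where c="?m / 4" and k=k
          and h="4 * ?m * (b * \<rho>)" and r="a * \<eta>\<^sup>2"])
      fix vs :: "(real^'n) list"
      assume "length vs = k" "set vs \<subseteq> signed_axes"
      then have "sum_list vs \<in> U" by (auto simp: U_def)
      with \<Phi> show "?m / 4 * R (sum_list vs) (sum_list vs)
          \<le> (norm ((rows_matrix \<Phi> ** D) *v sum_list vs))\<^sup>2"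
        unfolding rows_matrix_norm_square by (auto simp: L_def not_less)
    next
      fix i
      have "(norm ((rows_matrix \<Phi> ** D) *v axis i 1))\<^sup>2 \<le> 4 * ?m * R (axis i 1) (axis i 1)"
        using \<Phi> unfolding rows_matrix_norm_square by (auto simp: H_def not_less)
      also have "R (axis i 1) (axis i 1) \<le> b * (norm (column i D))\<^sup>2"
        unfolding R_def col by (rule up)
      also have "\<dots> \<le> b * \<rho>" using assms(8) ab by (intro mult_left_mono) auto
      finally show "(norm ((rows_matrix \<Phi> ** D) *v axis i 1))\<^sup>2 \<le> 4 * ?m * (b * \<rho>)" by simp
    next
      fix x :: "real^'n" and T
      assume x: "norm x = 1" "card T \<le> s" "l1_on (- T) x \<le> l1_on T x"
      \<comment> \<open>As \<open>\<gamma> < 1\<close>, the violators of the null space property,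
        which satisfy the cone condition with constant 1, lie in \<open>S_gamma\<close> once
        normalised.\<close>
      have "\<gamma> * l1_on (- T) x \<le> 1 * l1_on (- T) x"
        using assms(4) by (intro mult_right_mono) (auto simp: l1_on_def sum_nonneg)
      with x have "x \<in> S_gamma s \<gamma>" unfolding S_gamma_def by force
      from ge[OF this] have "\<eta>\<^sup>2 \<le> (norm (D *v x))\<^sup>2"
        using assms(6) by (intro power_mono) auto
      then have "a * \<eta>\<^sup>2 \<le> a * (norm (D *v x))\<^sup>2" using ab by simp
      also have "\<dots> \<le> R x x" unfolding R_def by (rule lo)
      finally show "a * \<eta>\<^sup>2 \<le> R x x" .
    next
      have "64 * (real s * (\<rho> / \<eta>\<^sup>2) * (b / a)) < real k - 1"
        using k(2) Xge by linarith
      then have "64 * (real s * (\<rho> / \<eta>\<^sup>2) * (b / a)) * (?m / 4 * (a * \<eta>\<^sup>2))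
          < (real k - 1) * (?m / 4 * (a * \<eta>\<^sup>2))"
        using ab assms(6) by (intro mult_strict_right_mono) auto
      also have "64 * (real s * (\<rho> / \<eta>\<^sup>2) * (b / a)) * (?m / 4 * (a * \<eta>\<^sup>2))
          = 4 * real s * (4 * ?m * (b * \<rho>))"
        using ab assms(6) by (simp add: field_simps)
      finally show "4 * real s * (4 * ?m * (b * \<rho>)) < (real k - 1) * (?m / 4 * (a * \<eta>\<^sup>2))" .
    qed (simp_all add: k_def)
    with \<Phi>(1) show False by (simp add: Good_def)
  qed
  have UL: "(\<Union>u\<in>U. L u) \<in> sets ?M" and UH: "(\<Union>i. H i) \<in> sets ?M"
    using L(1) H(1) finU by (auto intro: sets.finite_UN)
  have "measure ?M (space ?M - Good) \<le> measure ?M ((\<Union>u\<in>U. L u) \<union> (\<Union>i. H i))"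
    using UL UH by (intro P.finite_measure_mono sub sets.Un)
  also have "\<dots> \<le> measure ?M (\<Union>u\<in>U. L u) + measure ?M (\<Union>i. H i)"
    using UL UH by (rule measure_Un_le)
  also have "\<dots> \<le> (\<Sum>u\<in>U. measure ?M (L u)) + (\<Sum>i\<in>UNIV. measure ?M (H i))"
    using L H finU by (intro add_mono measure_UNION_le) auto
  also have "\<dots> \<le> real (card U) * exp (- ?m / 4) + real CARD('n) * exp (- ?m / 4)"
    using L H by (intro add_mono sum_bounded_above) auto
  also have "\<dots> = (real (card U) + real CARD('n)) * exp (- ?m / 4)"
    by (simp add: algebra_simps)
  \<comment> \<open>One further factor \<open>2 n\<close> pays for the \<open>n\<close> column
    events.\<close>
  also have "\<dots> \<le> ?N ^ (k + 1) * exp (- ?m / 4)"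
  proof (rule mult_right_mono)
    have n1: "1 \<le> real CARD('n)" by (simp add: Suc_leI)
    have "1 \<le> ?N ^ k" using n1 by (intro one_le_power) linarith
    then have "real CARD('n) * 1 \<le> real CARD('n) * ?N ^ k"
      by (rule mult_left_mono) simp
    moreover have "1 * ?N ^ k \<le> real CARD('n) * ?N ^ k"
      using n1 by (rule mult_right_mono) simp
    moreover have "?N ^ (k + 1) = real CARD('n) * ?N ^ k + real CARD('n) * ?N ^ k"
      by simp
    ultimately show "real (card U) + real CARD('n) \<le> ?N ^ (k + 1)"
      using cardU by linarith
  qed simp
  also have "?N ^ (k + 1) = exp (real (k + 1) * ln ?N)"
    by (simp only: exp_of_nat_mult) simp
  also have "\<dots> * exp (- ?m / 4) \<le> exp (- ?m / (128 * exp 1 * pi))"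
  proof -
    have "1 \<le> real CARD('n)" by (simp add: Suc_leI)
    then have ln0: "0 \<le> ln ?N" by (intro ln_ge_zero) linarith
    have pe: "3 * 2 \<le> pi * exp (1::real)"
      using pi_gt3 exp_ge_add_one_self[of 1] by (intro mult_mono) auto
    have XN: "0 \<le> X * ln ?N" using X1 ln0 by simp
    \<comment> \<open>Here 9216 is \<open>18 * 2^9\<close>, and \<open>pi * exp 1\<close> is
      replaced by its lower bound 6.\<close>
    have "9216 * 6 * (X * ln ?N) \<le> 9216 * (pi * exp 1) * (X * ln ?N)"
      using pe XN by (intro mult_right_mono) auto
    also have "\<dots> \<le> 9216 * (pi * exp 1) * (X * ln ?N) / \<gamma>\<^sup>2"
    proof -
      have "\<gamma>\<^sup>2 \<le> 1" using assms(3,4) by (simp add: power_le_one)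
      then show ?thesis using XN pe assms(3) by (simp add: pos_le_divide_eq mult_left_le)
    qed
    also have "\<dots> = (18 * 2^9 * pi * exp 1 / \<eta>\<^sup>2) * (\<rho> * cond_number \<Sigma> / \<gamma>\<^sup>2) * real s * ln ?N"
      by (simp add: X_def field_simps)
    also have "\<dots> \<le> ?m" by (rule assms(9))
    finally have mX: "9216 * 6 * (X * ln ?N) \<le> ?m" .
    \<comment> \<open>\<open>k + 1\<close> is at most \<open>64 * X + 3\<close>, hence at most
      \<open>67 * X\<close>.\<close>
    have "real (k + 1) * ln ?N \<le> (67 * X) * ln ?N"
      using k(1) X1 ln0 by (intro mult_right_mono) auto
    \<comment> \<open>The logarithmic term uses up only a small part of \<open>m/4\<close>. The
      target 768 is \<open>128 * 6\<close>, so that \<open>pi * exp 1 \<ge> 6\<close> gives the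
      stated exponent.\<close>
    then have "real (k + 1) * ln ?N - ?m / 4 \<le> - ?m / 768"
      using mX XN by simp
    also have "\<dots> \<le> - ?m / (128 * exp 1 * pi)"
    proof -
      have "?m / (128 * exp 1 * pi) \<le> ?m / 768"
        using pe by (intro divide_left_mono) (auto simp: mult.commute)
      then show ?thesis by simp
    qed
    finally show ?thesis by (simp flip: exp_add)
  qed
  finally have "measure ?M (space ?M - Good) \<le> exp (- ?m / (128 * exp 1 * pi))" .
  then show ?thesis
    using P.prob_compl[OF Good] by (simp add: Good_def)
qed

end
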